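(* Let $\lambda$ be an integer partition and let $S(\lambda)$ be the corresponding spider. Then $Y_{S(\lambda)}$ is 2-$s$-positive, or equivalently, the independence polynomial $I_{S(\lambda)}(t)$ is strongly log-concave.
   Context: For a partition $\lambda=(\lambda_1,\ldots,\lambda_\ell)$, the spider $S(\lambda)$ is the tree consisting of a vertex $v_0$ (the torso) together with $\ell$ pairwise disjoint paths (legs) having $\lambda_1,\ldots,\lambda_\ell$ vertices respectively, where one end vertex of each leg is joined by an edge to $v_0$. For a finite simple graph $G$, the independence polynomial is $I_G(t)=\sum_{j=0}^{\alpha(G)} i_jt^j$, where $i_j$ is the number of independent sets of $G$ of cardinality $j$ ($i_0=1$) and $\alpha(G)$ is the maximum size of an independent set. A polynomial $a_0+a_1t+\cdots+a_dt^d$ is strongly log-concave if $a_ma_n\ge a_pa_q$ for all integers $0\le p<m\le n<q\le d$ with $m+n=p+q$. Let $\mathbb{N}=\{0,1,2,\ldots\}$ and let $\mathbf{x}=\{x_1,x_2,\ldots\}$ be indeterminates. For $\alpha:V(G)\to\mathbb{N}$, a multicoloring of $G$ of type $\alpha$ is a map $\kappa$ assigning to each vertex $v$ a finite set $\kappa(v)$ of positive integers with $|\kappa(v)|=\alpha(v)$; it is proper if $\kappa(u)\cap\kappa(v)=\emptyset$ for every edge $uv$. Define $X_G^\alpha=\sum_\kappa x_1^{a_1}x_2^{a_2}\cdots$, summed over all proper multicolorings $\kappa$ of type $\alpha$, where $a_i$ is the number of vertices $v$ with $i\in\kappa(v)$. Define $Y_G=\sum_{\alpha:V(G)\to\mathbb{N}}X_G^\alpha$.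 This is a symmetric formal power series whose homogeneous components are symmetric functions; the coefficient $[s_\lambda]Y_G$ is the coefficient of the Schur function $s_\lambda$ in the component of degree $|\lambda|$. A symmetric function (or such a series) $f$ is 2-$s$-positive if $[s_\lambda]f\ge 0$ for all partitions $\lambda$ with length $\ell(\lambda)\le 2$. *)

theory Defs
  imports
    "HOL-Library.FuncSet"
    "HOL-Library.Poly_Mapping"
    "HOL-Computational_Algebra.Polynomial"
begin

section \<open>Graphs, independence polynomials\<close>

record 'v ugraph =
  verts :: "'v set"
  edges :: "'v set set"

definition simple_graph :: "'v ugraph \<Rightarrow> bool" where
  "simple_graph G \<longleftrightarrow> finite (verts G) \<and> (\<forall>e\<in>edges G. e \<subseteq> verts G \<and> card e = 2)"

definition independent :: "'v ugraph \<Rightarrow> 'v set \<Rightarrow> bool" where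
  "independent G S \<longleftrightarrow> S \<subseteq> verts G \<and> (\<forall>u\<in>S. \<forall>v\<in>S. {u, v} \<notin> edges G)"

definition indep_count :: "'v ugraph \<Rightarrow> nat \<Rightarrow> nat" where
  "indep_count G j = card {S. independent G S \<and> card S = j}"

definition indep_number :: "'v ugraph \<Rightarrow> nat" where
  "indep_number G = Max (card ` {S. independent G S})"

definition indep_poly :: "'v ugraph \<Rightarrow> int poly" where
  "indep_poly G = (\<Sum>j\<le>indep_number G. monom (int (indep_count G j)) j)"

definition strongly_log_concave :: "int poly \<Rightarrow> bool" where
  "strongly_log_concave P \<longleftrightarrow>
     (\<forall>m n p q. p < m \<and> m \<le> n \<and> n < q \<and> q \<le> degree P \<and> m + n = p + q \<longrightarrow>
        coeff P m * coeff P n \<ge> coeff P p * coeff P q)"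


section \<open>Partitions and spiders\<close>

definition is_partition :: "nat list \<Rightarrow> bool" where
  "is_partition lam \<longleftrightarrow> sorted_wrt (\<ge>) lam \<and> 0 \<notin> set lam"

definition partitions_of :: "nat \<Rightarrow> nat list set" where
  "partitions_of d = {lam. is_partition lam \<and> sum_list lam = d}"

text \<open>\<open>Leg i j\<close> is the vertex at distance \<open>j + 1\<close> from the torso on the \<open>i\<close>-th leg,
  with \<open>i\<close> and \<open>j\<close> counted from \<open>0\<close>.\<close>

datatype spider_vertex = Torso | Leg nat nat

definition spider :: "nat list \<Rightarrow> spider_vertex ugraph" where
  "spider lam =
     \<lparr>verts = {Torso} \<union> {Leg i j | i j. i < length lam \<and> j < lam ! i},
      edges = {{Torso, Leg i 0} | i. i < length lam \<and> 0 < lam ! i}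
            \<union> {{Leg i j, Leg i (Suc j)} | i j. i < length lam \<and> Suc j < lam ! i}\<rparr>"

lemma simple_graph_spider: "simple_graph (spider lam)"
proof -
  have "{Leg i j | i j. i < length lam \<and> j < lam ! i}
      = (\<lambda>(i, j). Leg i j) ` (SIGMA i:{..<length lam}. {..<lam ! i})"
    by auto
  then have "finite {Leg i j | i j. i < length lam \<and> j < lam ! i}"
    by simp
  then show ?thesis
    by (auto simp: simple_graph_def spider_def)
qed


section \<open>Formal power series in infinitely many variables\<close>

text \<open>A monomial is its finitely supported exponent vector and a series is its coefficient
  function.  The variables are \<open>x\<^sub>1, x\<^sub>2, \<dots>\<close>; index \<open>0\<close> is never used, so every series
  below has coefficient \<open>0\<close> at monomials whose support contains \<open>0\<close>.\<close>

type_synonym monomial = "nat \<Rightarrow>\<^sub>0 nat"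
type_synonym mseries = "monomial \<Rightarrow> int"

definition mdeg :: "monomial \<Rightarrow> nat" where
  "mdeg m = (\<Sum>i\<in>Poly_Mapping.keys m. Poly_Mapping.lookup m i)"

definition hom_component :: "nat \<Rightarrow> mseries \<Rightarrow> mseries" where
  "hom_component d f = (\<lambda>m. if mdeg m = d then f m else 0)"


section \<open>Schur functions\<close>

definition cells :: "nat list \<Rightarrow> (nat \<times> nat) set" where
  "cells lam = {(i, j). i < length lam \<and> j < lam ! i}"

definition ssyt :: "nat list \<Rightarrow> (nat \<times> nat \<Rightarrow> nat) \<Rightarrow> bool" where
  "ssyt lam T \<longleftrightarrow>
     T \<in> cells lam \<rightarrow>\<^sub>E {1..} \<and>
     (\<forall>i j. (i, Suc j) \<in> cells lam \<longrightarrow> T (i, j) \<le> T (i, Suc j)) \<and>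
     (\<forall>i j. (Suc i, j) \<in> cells lam \<longrightarrow> T (i, j) < T (Suc i, j))"

definition schur :: "nat list \<Rightarrow> mseries" where
  "schur lam = (\<lambda>m. int (card {T. ssyt lam T \<and>
      (\<forall>k. Poly_Mapping.lookup m k = card {c \<in> cells lam. T c = k})}))"

text \<open>The coefficient \<open>[s\<^sub>\<lambda>] f\<close>, read off from the unique expansion of the component of \<open>f\<close>
  of degree \<open>|\<lambda>|\<close> in the Schur basis; meaningful when that component is symmetric.\<close>

definition schur_coeff :: "mseries \<Rightarrow> nat list \<Rightarrow> int" where
  "schur_coeff f lam =
     (THE c. (\<forall>\<mu>. \<mu> \<notin> partitions_of (sum_list lam) \<longrightarrow> c \<mu> = 0) \<and>
             hom_component (sum_list lam) f
               = (\<lambda>m. \<Sum>\<mu>\<in>partitions_of (sum_list lam). c \<mu> * schur \<mu> m)) lam"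

definition two_s_positive :: "mseries \<Rightarrow> bool" where
  "two_s_positive f \<longleftrightarrow> (\<forall>lam. is_partition lam \<and> length lam \<le> 2 \<longrightarrow> schur_coeff f lam \<ge> 0)"


section \<open>Proper multicolorings and the series \<open>Y\<^sub>G\<close>\<close>

definition multicoloring :: "'v ugraph \<Rightarrow> ('v \<Rightarrow> nat) \<Rightarrow> ('v \<Rightarrow> nat set) \<Rightarrow> bool" where
  "multicoloring G \<alpha> \<kappa> \<longleftrightarrow>
     \<kappa> \<in> verts G \<rightarrow>\<^sub>E {C. finite C \<and> C \<subseteq> {1..}} \<and> (\<forall>v\<in>verts G. card (\<kappa> v) = \<alpha> v)"

definition proper_multicoloring :: "'v ugraph \<Rightarrow> ('v \<Rightarrow> nat) \<Rightarrow> ('v \<Rightarrow> nat set) \<Rightarrow> bool" where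
  "proper_multicoloring G \<alpha> \<kappa> \<longleftrightarrow>
     multicoloring G \<alpha> \<kappa> \<and> (\<forall>u v. {u, v} \<in> edges G \<longrightarrow> \<kappa> u \<inter> \<kappa> v = {})"

definition X_series :: "'v ugraph \<Rightarrow> ('v \<Rightarrow> nat) \<Rightarrow> mseries" where
  "X_series G \<alpha> = (\<lambda>m. int (card {\<kappa>. proper_multicoloring G \<alpha> \<kappa> \<and>
      (\<forall>i. Poly_Mapping.lookup m i = card {v \<in> verts G. i \<in> \<kappa> v})}))"

text \<open>The sum over all types \<open>\<alpha> : V(G) \<rightarrow> \<nat>\<close> is taken coefficientwise.  For a fixed monomial
  \<open>m\<close> and finite \<open>G\<close>, only types of total size \<open>mdeg m\<close> contribute, so the set of types with
  nonzero contribution is finite.\<close>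

definition Y_series :: "'v ugraph \<Rightarrow> mseries" where
  "Y_series G = (\<lambda>m. \<Sum>\<alpha> \<in> {\<alpha> \<in> verts G \<rightarrow>\<^sub>E UNIV. X_series G \<alpha> m \<noteq> 0}. X_series G \<alpha> m)"

end

theory Submission imports Defs begin

text \<open>
  Write \<open>I(t) = A(t) + t B(t)\<close> for the independence polynomial of a spider, where \<open>A\<close> is the product of the
  independence polynomials \<open>P\<^sub>n\<close> of the legs and \<open>B\<close> the product of the \<open>P\<^sub>n\<^sub>-\<^sub>1\<close>.  Both claims reduce to the
  positivity of \<open>I(x) I(y)\<close> in the basis of two-variable Schur polynomials: since \<open>Y\<close> is the product
  of the \<open>I(x\<^sub>i)\<close>, the coefficient of the partition \<open>(p, q)\<close> in \<open>Y\<close> is \<open>i\<^sub>p i\<^sub>q - i\<^sub>p\<^sub>+\<^sub>1 i\<^sub>q\<^sub>-\<^sub>1\<close>.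

  Two-variable Schur positivity is closed under products.  For a leg of length \<open>n\<close> there is a Schur
  positive \<open>d\<^sub>n\<close> with \<open>P\<^sub>n(x) P\<^sub>n\<^sub>-\<^sub>1(y) = d\<^sub>n\<^sub>+\<^sub>1 + x d\<^sub>n\<close> and \<open>P\<^sub>n(x) P\<^sub>n(y) = d\<^sub>n\<^sub>+\<^sub>1 + r\<^sub>n\<close>, where \<open>r\<^sub>n\<close> dominates
  \<open>(x + y) d\<^sub>n\<close>.  Expanding \<open>I(x) I(y)\<close> over sets \<open>S\<close> of legs, the only negative contributions are
  \<open>-(x y)\<^sup>2 h\<^sub>k\<^sub>-\<^sub>3 \<Prod>\<^sub>S d\<close> with \<open>k = |S| \<ge> 3\<close>, and they are absorbed by \<open>\<Prod>\<^sub>S r\<close> because of the three-leg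
  inequality \<open>(x y)\<^sup>2 d d' d'' \<le> r r' r''\<close>.
\<close>

section \<open>Schur positivity in two variables\<close>

type_synonym bipoly = "real poly poly"

definition x1 :: bipoly where "x1 = [:[:0, 1:]:]"
definition x2 :: bipoly where "x2 = [:0, 1:]"
definition e1 :: bipoly where "e1 = x1 + x2"
definition e2 :: bipoly where "e2 = x1 * x2"
definition cst :: "real \<Rightarrow> bipoly" where "cst c = [:[:c:]:]"
definition hsym :: "nat \<Rightarrow> bipoly" where "hsym d = (\<Sum>p<Suc d. x1 ^ p * x2 ^ (d - p))"

lemma x1_minus_x2_hsym: "(x1 - x2) * hsym d = x1 ^ Suc d - x2 ^ Suc d"
  unfolding hsym_def by (rule diff_power_eq_sum [symmetric])

lemma x1_neq_x2: "x1 - x2 \<noteq> 0"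
  by (simp add: x1_def x2_def)

text \<open>\<open>x1 - x2\<close> is the Vandermonde determinant of two variables. Multiplying by
  it turns each \<open>hsym\<close> into a difference of two monomials, so identities are checked
  there and the factor is cancelled afterwards.\<close>

lemma eq_if_times_x1_minus_x2: "(x1 - x2) * f = (x1 - x2) * g \<Longrightarrow> f = g"
  using x1_neq_x2 by simp

lemma hsym_0 [simp]: "hsym 0 = 1"
  by (simp add: hsym_def)

lemma hsym_1: "hsym (Suc 0) = e1"
  by (simp add: hsym_def e1_def add.commute)

text \<open>One step of the Clebsch-Gordan rule: the top constituent splits off and
  \<open>e2\<close> times a smaller product remains.\<close>

lemma hsym_Suc_mult_hsym_Suc: "hsym (Suc d) * hsym (Suc e) = hsym (Suc (Suc (d + e))) + e2 * (hsym d * hsym e)"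
proof -
  have "(x1 - x2) * ((x1 - x2) * (hsym (Suc d) * hsym (Suc e))) = ((x1 - x2) * hsym (Suc d)) * ((x1 - x2) * hsym (Suc e))"
    by (simp only: mult_ac)
  also have "\<dots> = (x1 ^ (d + 2) - x2 ^ (d + 2)) * (x1 ^ (e + 2) - x2 ^ (e + 2))"
    by (simp only: x1_minus_x2_hsym) simp
  also have "\<dots> = (x1 - x2) * (x1 ^ (d + e + 3) - x2 ^ (d + e + 3))
      + e2 * (x1 ^ (d + 1) - x2 ^ (d + 1)) * (x1 ^ (e + 1) - x2 ^ (e + 1))"
    unfolding e2_def by (simp add: power_add algebra_simps power2_eq_square power3_eq_cube)
  also have "\<dots> = (x1 - x2) * ((x1 - x2) * hsym (Suc (Suc (d + e))))
      + e2 * ((x1 - x2) * hsym d) * ((x1 - x2) * hsym e)"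
    by (simp only: x1_minus_x2_hsym) (simp add: eval_nat_numeral)
  also have "\<dots> = (x1 - x2) * ((x1 - x2) * (hsym (Suc (Suc (d + e))) + e2 * (hsym d * hsym e)))"
    by (simp only: distrib_left mult_ac)
  finally show ?thesis
    using eq_if_times_x1_minus_x2 by blast
qed

lemma cst_simps [simp]:
  "cst 0 = 0" "cst 1 = 1" "cst c * cst c' = cst (c * c')" "cst c + cst c' = cst (c + c')"
  by (simp_all add: cst_def one_pCons)

lemma coeff_cst_mult: "coeff (coeff (cst c * f) j) i = c * coeff (coeff f j) i"
  by (simp add: cst_def)

text \<open>\<open>e2 ^ b * hsym d\<close> is the two-variable Schur polynomial of the partition \<open>(d + b, b)\<close>.\<close>

inductive_set spos :: "bipoly set" where
  spos_0: "0 \<in> spos"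
| spos_step: "f \<in> spos \<Longrightarrow> c \<ge> 0 \<Longrightarrow> f + cst c * (e2 ^ b * hsym d) \<in> spos"

lemma spos_gen: "c \<ge> 0 \<Longrightarrow> cst c * (e2 ^ b * hsym d) \<in> spos"
  using spos_step [OF spos_0] by simp

lemma spos_add [intro!]: "g \<in> spos \<Longrightarrow> f \<in> spos \<Longrightarrow> f + g \<in> spos"
proof (induction g rule: spos.induct)
  case (spos_step g c b d)
  then have "f + g + cst c * (e2 ^ b * hsym d) \<in> spos"
    by (intro spos.spos_step)
  then show ?case by (simp only: add.assoc)
qed simp

lemma spos_sum [intro!]: "(\<And>i. i \<in> A \<Longrightarrow> f i \<in> spos) \<Longrightarrow> sum f A \<in> spos"
  by (induction A rule: infinite_finite_induct) (auto intro: spos.intros)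

text \<open>The Clebsch-Gordan step is iterated. The power of \<open>e2\<close> is part of the
  induction because every step produces one more factor.\<close>

lemma hsym_mult_hsym_spos: "e2 ^ b * (hsym d * hsym e) \<in> spos"
proof (induction d arbitrary: e b)
  case 0
  then show ?case using spos_gen [of 1 b e] by simp
next
  case (Suc d)
  show ?case
  proof (cases e)
    case 0
    then show ?thesis using spos_gen [of 1 b "Suc d"] by simp
  next
    case (Suc e')
    have "e2 ^ b * hsym (Suc (Suc (d + e'))) \<in> spos"
      using spos_gen [of 1] by simp
    moreover have "e2 ^ Suc b * (hsym d * hsym e') \<in> spos"
      by (rule Suc.IH)
    ultimately have "e2 ^ b * hsym (Suc (Suc (d + e'))) + e2 ^ Suc b * (hsym d * hsym e') \<in> spos"
      by (rule spos_add [rotated])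
    then show ?thesis
      by (simp add: Suc hsym_Suc_mult_hsym_Suc distrib_left mult_ac)
  qed
qed

lemma spos_cst_mult: "f \<in> spos \<Longrightarrow> c \<ge> 0 \<Longrightarrow> cst c * f \<in> spos"
proof (induction f rule: spos.induct)
  case (spos_step f c' b d)
  then have "cst c * f + cst (c * c') * (e2 ^ b * hsym d) \<in> spos"
    by (intro spos.spos_step) auto
  then show ?case
    by (simp add: distrib_left mult.assoc [symmetric])
qed (auto intro: spos.intros)

lemma spos_mult [intro!]: "f \<in> spos \<Longrightarrow> g \<in> spos \<Longrightarrow> f * g \<in> spos"
proof (induction f rule: spos.induct)
  case (spos_step f c b d)
  have "cst c * (e2 ^ b * hsym d) * g \<in> spos"
    using \<open>g \<in> spos\<close>
  proof (induction g rule: spos.induct)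
    case (spos_step g c' b' d')
    have "cst (c * c') * (e2 ^ (b + b') * (hsym d * hsym d')) \<in> spos"
      using \<open>c \<ge> 0\<close> \<open>c' \<ge> 0\<close> by (intro spos_cst_mult hsym_mult_hsym_spos) auto
    also have "cst (c * c') * (e2 ^ (b + b') * (hsym d * hsym d'))
        = cst c * (e2 ^ b * hsym d) * (cst c' * (e2 ^ b' * hsym d'))"
      by (simp only: cst_simps(3) [symmetric] power_add mult_ac)
    finally show ?case
      using spos_step.IH by (auto simp: distrib_left)
  qed (auto intro: spos.intros)
  then show ?case
    using spos_step by (auto simp: distrib_right)
qed (auto intro: spos.intros)

lemma spos_cst: "c \<ge> 0 \<Longrightarrow> cst c \<in> spos"
  using spos_gen [of c 0 0] by simp

lemma spos_1 [simp]: "1 \<in> spos"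
  using spos_cst [of 1] by simp

lemma spos_hsym [simp]: "hsym d \<in> spos"
  using spos_gen [of 1 0 d] by simp

lemma spos_e1 [simp]: "e1 \<in> spos"
  using spos_hsym [of 1] by (simp add: hsym_1)

lemma spos_e2 [simp]: "e2 \<in> spos"
  using spos_gen [of 1 1 0] by simp

lemma spos_prod [intro!]: "(\<And>i. i \<in> A \<Longrightarrow> f i \<in> spos) \<Longrightarrow> prod f A \<in> spos"
  by (induction A rule: infinite_finite_induct) auto

lemma spos_power [intro!]: "f \<in> spos \<Longrightarrow> f ^ n \<in> spos"
  by (induction n) auto

lemma spos_of_nat [simp]: "of_nat n \<in> spos"
  by (induction n) (auto intro: spos.intros)

lemma spos_numeral [simp]: "numeral n \<in> spos"
  using spos_of_nat [of "numeral n"] by simp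

section \<open>The preorder of the Schur-positive cone\<close>

definition sle :: "bipoly \<Rightarrow> bipoly \<Rightarrow> bool" (infix "\<preceq>" 50) where
  "f \<preceq> g \<longleftrightarrow> g - f \<in> spos"

lemma sle_refl [simp]: "f \<preceq> f"
  by (simp add: sle_def spos_0)

lemma sle_trans [trans]: "f \<preceq> g \<Longrightarrow> g \<preceq> k \<Longrightarrow> f \<preceq> k"
  unfolding sle_def by (drule (1) spos_add [rotated]) simp

lemma sle_add: "f \<preceq> g \<Longrightarrow> f' \<preceq> g' \<Longrightarrow> f + f' \<preceq> g + g'"
  unfolding sle_def by (drule (1) spos_add [rotated]) (simp add: algebra_simps)

lemma sle_sum: "(\<And>i. i \<in> A \<Longrightarrow> f i \<preceq> g i) \<Longrightarrow> sum f A \<preceq> sum g A"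
  unfolding sle_def by (simp add: sum_subtractf [symmetric] spos_sum)

lemma sle_mult:
  assumes "f \<preceq> g" "f' \<preceq> g'" "f \<in> spos" "g' \<in> spos"
  shows "f * f' \<preceq> g * g'"
proof -
  have "(g - f) * g' + f * (g' - f') \<in> spos"
    using assms unfolding sle_def by auto
  then show ?thesis
    by (simp add: sle_def algebra_simps)
qed

lemma sle_mult_left: "f \<preceq> g \<Longrightarrow> k \<in> spos \<Longrightarrow> k * f \<preceq> k * g"
  unfolding sle_def by (simp add: right_diff_distrib [symmetric] spos_mult)

lemma sle_mult_right: "f \<preceq> g \<Longrightarrow> k \<in> spos \<Longrightarrow> f * k \<preceq> g * k"
  using sle_mult_left by (simp add: mult.commute)

lemma spos_sle: "f \<in> spos \<Longrightarrow> f \<preceq> g \<Longrightarrow> g \<in> spos"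
  unfolding sle_def by (drule (1) spos_add [rotated]) simp

lemma sle_add_spos: "f \<in> spos \<Longrightarrow> g \<preceq> g + f"
  by (simp add: sle_def)

lemma sle_prod:
  "(\<And>i. i \<in> A \<Longrightarrow> f i \<preceq> g i) \<Longrightarrow> (\<And>i. i \<in> A \<Longrightarrow> f i \<in> spos) \<Longrightarrow> prod f A \<preceq> prod g A"
proof (induction A rule: infinite_finite_induct)
  case (insert a A)
  have "prod g A \<in> spos"
    using insert.prems spos_sle by blast
  with insert show ?case by (simp add: sle_mult)
qed auto

text \<open>The difference is \<open>hsym 2\<close>. Later this is the exchange that supplies the
  factors \<open>e1\<close> demanded by the leg bounds, at the price of one
  \<open>e2\<close>.\<close>

lemma e2_sle_e1_sq: "e2 \<preceq> e1 * e1"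
  using hsym_Suc_mult_hsym_Suc [of 0 0] spos_hsym [of 2]
  by (simp add: hsym_1 sle_def numeral_2_eq_2)

lemma hsym_sle_e1_power: "hsym d \<preceq> e1 ^ d"
proof (induction d)
  case (Suc d)
  have "hsym (Suc d) \<preceq> e1 * hsym d"
  proof (cases d)
    case (Suc d')
    then have "e1 * hsym d = hsym (Suc d) + e2 * hsym d'"
      using hsym_Suc_mult_hsym_Suc [of 0 d'] by (simp add: hsym_1)
    then show ?thesis by (auto simp: sle_def)
  qed (simp add: hsym_1)
  also have "\<dots> \<preceq> e1 * e1 ^ d"
    using Suc by (intro sle_mult_left) auto
  finally show ?case by simp
qed simp

text \<open>\<open>x2\<close> is the outer polynomial variable: the inner \<open>coeff\<close> reads
  the exponent of \<open>x2\<close>, the outer one that of \<open>x1\<close>.\<close>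

lemma coeff_x1_power_x2_power: "coeff (coeff (x1 ^ i * x2 ^ j) j') i' = (if i = i' \<and> j = j' then 1 else 0)"
proof -
  have "x1 ^ i = [:monom 1 i:]"
    by (simp add: x1_def poly_const_pow monom_altdef)
  moreover have "x2 ^ j = monom 1 j"
    by (simp add: x2_def monom_altdef)
  ultimately show ?thesis
    by (simp add: coeff_monom)
qed

text \<open>Times \<open>x1 - x2\<close>, a generator becomes
  \<open>x1 ^ (b + Suc d) * x2 ^ b\<close> minus its mirror image. The negative monomial has the
  larger exponent at \<open>x2\<close>, so \<open>j < i\<close> never sees it.\<close>

lemma spos_coeff_nonneg:
  assumes "f \<in> spos" "j < i"
  shows "coeff (coeff ((x1 - x2) * f) j) i \<ge> 0"
  using assms(1)
proof (induction rule: spos.induct)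
  case (spos_step f c b d)
  have "(x1 - x2) * (cst c * (e2 ^ b * hsym d)) = cst c * (e2 ^ b * ((x1 - x2) * hsym d))"
    by (simp only: mult_ac)
  also have "\<dots> = cst c * (x1 ^ (b + Suc d) * x2 ^ b - x1 ^ b * x2 ^ (b + Suc d))"
    by (simp only: x1_minus_x2_hsym) (simp add: e2_def power_mult_distrib power_add algebra_simps)
  finally have "coeff (coeff ((x1 - x2) * (cst c * (e2 ^ b * hsym d))) j) i \<ge> 0"
    using \<open>c \<ge> 0\<close> \<open>j < i\<close>
    by (simp only: coeff_cst_mult coeff_diff coeff_x1_power_x2_power) simp
  with spos_step show ?case
    by (simp add: distrib_left)
qed simp

section \<open>Path polynomials\<close>

text \<open>Shifted indexing: the path with \<open>n\<close> vertices has independence polynomial \<open>fibp (Suc n)\<close>, and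
  \<open>fibp 0 = 1\<close> stands for \<open>P\<^sub>-\<^sub>1\<close>, which makes the recursion start one step earlier.\<close>

fun fibp :: "nat \<Rightarrow> 'a::comm_ring_1 \<Rightarrow> 'a" where
  "fibp 0 t = 1"
| "fibp (Suc 0) t = 1"
| "fibp (Suc (Suc n)) t = fibp (Suc n) t + t * fibp n t"

definition path_sq :: "nat \<Rightarrow> bipoly" where "path_sq n = fibp n x1 * fibp n x2"

text \<open>This is d_n of the overview. Its recursion is forced: expanding the longer factor of the
  mixed product once leaves \<open>path_sq (Suc n)\<close> plus \<open>x1\<close> times the mirrored
  product of the next smaller size, and \<open>x1 * x2 = e2\<close> there yields the second
  summand.\<close>

fun cross_poly :: "nat \<Rightarrow> bipoly" where
  "cross_poly 0 = 0"
| "cross_poly (Suc 0) = 1"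
| "cross_poly (Suc (Suc n)) = path_sq (Suc n) + e2 * cross_poly n"

text \<open>Each expansion exchanges the roles of \<open>x1\<close> and \<open>x2\<close>, so the
  two identities need a common induction.\<close>

lemma fibp_cross:
  "fibp (Suc n) x1 * fibp n x2 = cross_poly (Suc n) + x1 * cross_poly n"
  "fibp (Suc n) x2 * fibp n x1 = cross_poly (Suc n) + x2 * cross_poly n"
proof (induction n)
  case (Suc n)
  have "fibp (Suc (Suc n)) x1 * fibp (Suc n) x2 = path_sq (Suc n) + x1 * (fibp (Suc n) x2 * fibp n x1)"
    by (simp add: path_sq_def algebra_simps)
  then show "fibp (Suc (Suc n)) x1 * fibp (Suc n) x2 = cross_poly (Suc (Suc n)) + x1 * cross_poly (Suc n)"
    by (simp only: Suc.IH) (simp add: e2_def algebra_simps)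
  have "fibp (Suc (Suc n)) x2 * fibp (Suc n) x1 = path_sq (Suc n) + x2 * (fibp (Suc n) x1 * fibp n x2)"
    by (simp add: path_sq_def algebra_simps)
  then show "fibp (Suc (Suc n)) x2 * fibp (Suc n) x1 = cross_poly (Suc (Suc n)) + x2 * cross_poly (Suc n)"
    by (simp only: Suc.IH) (simp add: e2_def algebra_simps)
qed simp_all

text \<open>This is r_n of the overview. For n \<ge> 1 it is what remains when the factor in
  \<open>x2\<close> of \<open>path_sq (Suc n)\<close> is expanded once and then, in the shorter
  product, the factor in \<open>x1\<close>. The asymmetric pieces combine to \<open>e1\<close> and
  \<open>e2\<close>, which makes positivity visible.\<close>

definition path_rest :: "nat \<Rightarrow> bipoly" where
  "path_rest n = e1 * cross_poly n + e2 * path_sq (n - 1) + e2 * cross_poly (n - 1)"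

lemma path_sq_Suc:
  assumes "n \<ge> 1"
  shows "path_sq (Suc n) = cross_poly (Suc n) + path_rest n"
proof -
  obtain m where m: "n = Suc m"
    using assms by (cases n) auto
  have "path_sq (Suc n) = fibp (Suc (Suc m)) x1 * fibp (Suc m) x2
      + x2 * (fibp (Suc m) x1 * fibp m x2) + x1 * x2 * (fibp m x1 * fibp m x2)"
    by (simp add: m path_sq_def algebra_simps)
  also have "\<dots> = cross_poly (Suc n) + x1 * cross_poly n + x2 * (cross_poly n + x1 * cross_poly m) + e2 * path_sq m"
    by (simp only: fibp_cross m e2_def path_sq_def)
  also have "\<dots> = cross_poly (Suc n) + path_rest n"
    by (simp only: path_rest_def m) (simp add: e1_def e2_def algebra_simps)
  finally show ?thesis .
qed

lemma path_sq_cross_poly_spos: "path_sq n \<in> spos \<and> cross_poly n \<in> spos"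
proof (induction n rule: less_induct)
  case (less n)
  consider "n = 0" | "n = 1" | m where "n = Suc (Suc m)"
    by (metis One_nat_def not0_implies_Suc)
  then show ?case
  proof cases
    case 3
    with less have "path_sq m \<in> spos" "cross_poly m \<in> spos" "path_sq (Suc m) \<in> spos" "cross_poly (Suc m) \<in> spos"
      by auto
    then show ?thesis
      by (auto simp: 3 path_sq_Suc path_rest_def)
  qed (auto simp: path_sq_def intro: spos_0)
qed

lemma spos_path_sq [simp]: "path_sq n \<in> spos" and spos_cross_poly [simp]: "cross_poly n \<in> spos"
  using path_sq_cross_poly_spos by auto

lemma spos_path_rest [simp]: "path_rest n \<in> spos"
  unfolding path_rest_def by auto

text \<open>The summands of the unrolled recursion of \<open>cross_poly\<close>. Being 0 from
  \<open>2 * i \<ge> n\<close> on, they allow legs of different lengths to share one summation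
  bound.\<close>

definition cross_term :: "nat \<Rightarrow> nat \<Rightarrow> bipoly" where
  "cross_term n i = (if 2 * i < n then e2 ^ i * path_sq (n - 1 - 2 * i) else 0)"

lemma spos_cross_term [simp]: "cross_term n i \<in> spos"
  by (auto simp: cross_term_def intro: spos_0)

lemma cross_term_Suc_Suc [simp]:
  "cross_term (Suc (Suc n)) 0 = path_sq (Suc n)" "cross_term (Suc (Suc n)) (Suc i) = e2 * cross_term n i"
  by (auto simp: cross_term_def)

lemma cross_term_0 [simp]: "cross_term 0 i = 0" and cross_term_1_0 [simp]: "cross_term (Suc 0) 0 = path_sq 0"
  and cross_term_1_Suc [simp]: "cross_term (Suc 0) (Suc i) = 0"
  by (auto simp: cross_term_def)

lemma cross_poly_eq_sum_cross_term: "n \<le> N \<Longrightarrow> cross_poly n = (\<Sum>i<N. cross_term n i)"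
proof (induction n arbitrary: N rule: cross_poly.induct)
  case 2
  then show ?case
    by (cases N) (auto simp: sum.lessThan_Suc_shift path_sq_def simp del: sum.lessThan_Suc)
next
  case (3 n)
  then obtain N' where N: "N = Suc N'" by (cases N) auto
  have "cross_poly n = (\<Sum>i<N'. cross_term n i)"
    using 3 N by auto
  then show ?case
    by (simp add: N sum.lessThan_Suc_shift sum_distrib_left del: sum.lessThan_Suc)
qed simp

lemma path_sq_step: "e1 * cross_poly (Suc n) + e2 * path_sq n \<preceq> path_sq (Suc (Suc n))"
  by (auto simp: path_sq_Suc path_rest_def sle_def)

text \<open>By \<open>path_sq_step\<close>, \<open>e2\<close> times a square is dominated by the
  square two steps later, so unrolling further never exceeds the leading term.\<close>

lemma cross_term_sle_path_sq: "cross_term n k \<preceq> path_sq (n - 1)"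
proof (induction n arbitrary: k rule: cross_poly.induct)
  case (2 k)
  then show ?case by (cases k) (auto simp: sle_def)
next
  case (3 n)
  show ?case
  proof (cases k)
    case (Suc k')
    show ?thesis
    proof (cases n)
      case (Suc m)
      have "e2 * cross_term n k' \<preceq> e2 * path_sq (n - 1)"
        by (intro sle_mult_left "3.IH") auto
      also have "\<dots> \<preceq> e1 * cross_poly (Suc m) + e2 * path_sq m"
        using Suc by (auto simp: sle_def)
      also have "\<dots> \<preceq> path_sq (Suc n)"
        unfolding Suc by (rule path_sq_step)
      finally show ?thesis using \<open>k = Suc k'\<close> by simp
    qed (simp add: Suc sle_def)
  qed simp
qed (simp add: sle_def)

text \<open>Shifting the index by one adds an unweighted copy of the sum, which is
  \<open>cross_poly n\<close>. The induction hypothesis and this extra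
  \<open>e1 * cross_poly n\<close> together are exactly what \<open>path_sq_step\<close>
  absorbs.\<close>

lemma sum_cross_term_sle_path_sq: "n \<le> N \<Longrightarrow> e1 * (\<Sum>i<N. of_nat i * cross_term n i) \<preceq> e2 * path_sq (n - 1)"
proof (induction n arbitrary: N rule: cross_poly.induct)
  case (2 N)
  then obtain N' where N: "N = Suc N'" by (cases N) auto
  show ?case
    by (auto simp: N sum.lessThan_Suc_shift sle_def simp del: sum.lessThan_Suc)
next
  case (3 n)
  then obtain N' where N: "N = Suc N'" by (cases N) auto
  have "(\<Sum>i<N. of_nat i * cross_term (Suc (Suc n)) i) = e2 * ((\<Sum>i<N'. of_nat i * cross_term n i) + (\<Sum>i<N'. cross_term n i))"
    by (simp add: N sum.lessThan_Suc_shift sum_distrib_left sum.distrib algebra_simps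
             del: sum.lessThan_Suc)
  also have "(\<Sum>i<N'. cross_term n i) = cross_poly n"
    using 3 N by (intro cross_poly_eq_sum_cross_term [symmetric]) simp
  finally have eq: "e1 * (\<Sum>i<N. of_nat i * cross_term (Suc (Suc n)) i)
      = e2 * (e1 * (\<Sum>i<N'. of_nat i * cross_term n i) + e1 * cross_poly n)"
    by (simp add: algebra_simps)
  show ?case
  proof (cases n)
    case (Suc m)
    have "e1 * (\<Sum>i<N'. of_nat i * cross_term n i) + e1 * cross_poly n \<preceq> e2 * path_sq (n - 1) + e1 * cross_poly n"
      using 3 N by (intro sle_add) auto
    also have "\<dots> \<preceq> path_sq (Suc n)"
      using path_sq_step [of m] Suc by (simp add: add.commute)
    finally show ?thesis
      unfolding eq by (auto intro: sle_mult_left)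
  next
    case 0
    show ?thesis unfolding eq by (auto simp: 0 sle_def)
  qed
qed (auto simp: sle_def)

text \<open>All that the three-leg inequality uses about a leg, with \<open>u\<close> in the role of
  the leading term. \<open>N \<ge> 2\<close> permits splitting off the indices 0 and 1, whose
  weights in the last bound are too small to be of use.\<close>

definition leg_bounds :: "nat \<Rightarrow> (nat \<Rightarrow> bipoly) \<Rightarrow> bipoly \<Rightarrow> bool" where
  "leg_bounds N g u \<longleftrightarrow> N \<ge> 2 \<and> (\<forall>i. g i \<in> spos) \<and> (\<forall>i. g i \<preceq> u) \<and>
     e1 * (\<Sum>i<N. of_nat i * g i) \<preceq> e2 * u"

lemma leg_bounds_cross_term: "n \<le> N \<Longrightarrow> 2 \<le> N \<Longrightarrow> leg_bounds N (cross_term n) (path_sq (n - 1))"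
  unfolding leg_bounds_def by (intro conjI allI cross_term_sle_path_sq sum_cross_term_sle_path_sq) auto

lemma sum_split_2: "N \<ge> 2 \<Longrightarrow> (\<Sum>i<N. f i) = f 0 + f 1 + (\<Sum>i=2..<N. f i)" for f :: "nat \<Rightarrow> bipoly"
  by (metis (no_types, lifting) ext One_nat_def Suc_1 add.assoc atLeast0LessThan not_less_eq_eq
      nat_le_linear not0_implies_Suc le_zero_eq sum.atLeast_Suc_lessThan Suc_le_lessD less_le_trans zero_less_two)

text \<open>Telescoping, since 1/n^2 is at most 1/(n - 1) - 1/n.\<close>

lemma sum_inverse_squares_le_1: "(\<Sum>i=2..<N. 1 / (real i)\<^sup>2) \<le> 1"
proof (cases "N \<ge> 2")
  case True
  have "(\<Sum>i=2..<N. 1 / (real i)\<^sup>2) \<le> 1 - 1 / (real N - 1)"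
    using True
  proof (induction N rule: dec_induct)
    case (step n)
    have "1 / (real n)\<^sup>2 \<le> 1 / (real n - 1) - 1 / real n"
      using step.hyps by (simp add: field_simps power2_eq_square)
    with step show ?case by simp
  qed simp
  also have "\<dots> \<le> 1" using True by simp
  finally show ?thesis .
qed simp

text \<open>With p = b c, q = a c, r = a b the summands are p^3, q^3 and r^3 divided by p q r, so
  this is AM-GM for three cubes.\<close>

lemma triple_weight_ge_3:
  fixes a b c :: real
  assumes "a > 0" "b > 0" "c > 0"
  shows "1 / a\<^sup>2 * b * c + a * (1 / b\<^sup>2) * c + a * b * (1 / c\<^sup>2) \<ge> 3"
proof -
  define p q r where "p = b * c" "q = a * c" "r = a * b"
  have pos: "p > 0" "q > 0" "r > 0" using assms by (auto simp: p_q_r_def)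
  have "(p + q + r) * ((p - q)\<^sup>2 + (q - r)\<^sup>2 + (p - r)\<^sup>2) \<ge> 0"
    using pos by simp
  then have "p ^ 3 + q ^ 3 + r ^ 3 \<ge> 3 * (p * q * r)"
    by (simp add: algebra_simps power2_eq_square power3_eq_cube)
  then show ?thesis
    using assms unfolding p_q_r_def
    by (simp add: field_simps power2_eq_square power3_eq_cube)
qed

section \<open>The three-leg inequality\<close>

lemma triple_sum_product:
  "(\<Sum>i\<in>A. cst (a i) * f i) * (\<Sum>j\<in>A. cst (b j) * g j) * (\<Sum>k\<in>A. cst (c k) * k' k)
   = (\<Sum>i\<in>A. \<Sum>j\<in>A. \<Sum>k\<in>A. cst (a i * b j * c k) * (f i * g j * k' k))"
proof -
  have "(\<Sum>i\<in>A. cst (a i) * f i) * (\<Sum>j\<in>A. cst (b j) * g j) * (\<Sum>k\<in>A. cst (c k) * k' k)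
    = (\<Sum>i\<in>A. cst (a i) * f i) * (\<Sum>j\<in>A. \<Sum>k\<in>A. cst (b j) * g j * (cst (c k) * k' k))"
    by (simp only: mult.assoc [of "sum _ A"] sum_product [of "\<lambda>j. cst (b j) * g j" A "\<lambda>k. cst (c k) * k' k" A])
  also have "\<dots> = (\<Sum>i\<in>A. \<Sum>j\<in>A. \<Sum>k\<in>A. cst (a i) * f i * (cst (b j) * g j * (cst (c k) * k' k)))"
    by (subst sum_distrib_right) (simp only: sum_distrib_left)
  finally show ?thesis
    by (simp only: cst_simps(3) [symmetric] mult_ac)
qed

lemma of_nat_cst: "of_nat n = cst (real n)"
  by (simp add: cst_def of_nat_poly)

lemma cst_diff: "cst (a - b) = cst a - cst b"
  by (simp add: cst_def)

lemma numeral_cst: "numeral n = cst (numeral n)"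
  using of_nat_cst [of "numeral n"] by simp

text \<open>The weights \<open>1 / k\<^sup>2\<close> make the coefficient of \<open>G1 i * G2 j * G3 k\<close> at least \<open>3\<close> by AM-GM,
  while their sum over \<open>k \<ge> 2\<close> is at most \<open>1\<close>.\<close>

lemma weighted_tail_product:
  fixes G1 G2 G3 :: "nat \<Rightarrow> bipoly" and N :: nat
  assumes "\<And>i. G1 i \<in> spos" "\<And>i. G2 i \<in> spos" "\<And>i. G3 i \<in> spos"
  defines "r \<equiv> (\<lambda>G :: nat \<Rightarrow> bipoly. \<Sum>i=2..<N. G i)"
    and "V \<equiv> (\<lambda>G. \<Sum>i=2..<N. cst (1 / (real i)\<^sup>2) * G i)"
    and "M \<equiv> (\<lambda>G. \<Sum>i=2..<N. of_nat i * G i)"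
  shows "3 * (r G1 * r G2 * r G3) \<preceq> V G1 * M G2 * M G3 + M G1 * V G2 * M G3 + M G1 * M G2 * V G3"
proof -
  let ?T = "\<lambda>w. \<Sum>i=2..<N. \<Sum>j=2..<N. \<Sum>k=2..<N. cst (w i j k) * (G1 i * G2 j * G3 k)"
  have l1: "3 * (r G1 * r G2 * r G3)
      = (\<Sum>i=2..<N. cst 3 * G1 i) * (\<Sum>i=2..<N. cst 1 * G2 i) * (\<Sum>i=2..<N. cst 1 * G3 i)"
    by (simp add: r_def numeral_cst sum_distrib_left [symmetric] mult.assoc)
  have l2: "\<dots> = ?T (\<lambda>i j k. 3)"
    by (simp only: triple_sum_product mult_1_right)
  let ?W = "?T (\<lambda>i j k. 1 / (real i)\<^sup>2 * real j * real k + real i * (1 / (real j)\<^sup>2) * real k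
      + real i * real j * (1 / (real k)\<^sup>2))"
  have l3: "?T (\<lambda>i j k. 3) \<preceq> ?W"
  proof (intro sle_sum)
    fix i j k
    let ?w = "1 / (real i)\<^sup>2 * real j * real k + real i * (1 / (real j)\<^sup>2) * real k
      + real i * real j * (1 / (real k)\<^sup>2)"
    assume "i \<in> {2..<N}" "j \<in> {2..<N}" "k \<in> {2..<N}"
    then have "?w \<ge> 3"
      by (intro triple_weight_ge_3) auto
    then have "cst (?w - 3) * (G1 i * G2 j * G3 k) \<in> spos"
      using assms(1-3) by (intro spos_cst_mult) auto
    then show "cst 3 * (G1 i * G2 j * G3 k) \<preceq> cst (?w) * (G1 i * G2 j * G3 k)"
      by (simp only: sle_def left_diff_distrib [symmetric] cst_diff [symmetric])
  qed
  have l4: "?W = ?T (\<lambda>i j k. 1 / (real i)\<^sup>2 * real j * real k) + ?T (\<lambda>i j k. real i * (1 / (real j)\<^sup>2) * real k)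
      + ?T (\<lambda>i j k. real i * real j * (1 / (real k)\<^sup>2))"
    by (simp only: cst_simps(4) [symmetric] distrib_right sum.distrib)
  have l5: "\<dots> = V G1 * M G2 * M G3 + M G1 * V G2 * M G3 + M G1 * M G2 * V G3"
    unfolding V_def M_def of_nat_cst triple_sum_product ..
  show ?thesis
    using l3 unfolding l1 l2 l4 l5 .
qed

text \<open>Each \<open>d\<close> is split at index 2 into a head \<open>z\<close> and a tail
  \<open>r\<close>. On the right, \<open>A\<close>, \<open>B\<close>, \<open>C\<close> collect the
  products with one, two and three factors \<open>u\<close>. Heads satisfy only
  \<open>z \<preceq> 2 * u\<close>, so twice the inequality is proved: products containing a head go
  below \<open>2 * A\<close> and \<open>2 * B\<close>, the pure tail product below
  \<open>C\<close>.\<close>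

lemma leg_bounds_triple:
  assumes "leg_bounds N G1 u1" "leg_bounds N G2 u2" "leg_bounds N G3 u3"
  defines "d \<equiv> (\<lambda>G. \<Sum>i<N. G i)"
  shows "e2\<^sup>2 * (d G1 * d G2 * d G3) \<preceq> (e1 * d G1 + e2 * u1) * (e1 * d G2 + e2 * u2) * (e1 * d G3 + e2 * u3)"
proof -
  define r where "r = (\<lambda>G :: nat \<Rightarrow> bipoly. \<Sum>i=2..<N. G i)"
  define V where "V = (\<lambda>G. \<Sum>i=2..<N. cst (1 / (real i)\<^sup>2) * G i)"
  define M where "M = (\<lambda>G :: nat \<Rightarrow> bipoly. \<Sum>i=2..<N. of_nat i * G i)"
  define z where "z = (\<lambda>G :: nat \<Rightarrow> bipoly. G 0 + G 1)"
  have props: "G i \<in> spos" "u \<in> spos" "d G \<in> spos" "r G \<in> spos" "V G \<in> spos" "M G \<in> spos" "z G \<in> spos"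
    "d G = z G + r G" "z G \<preceq> 2 * u" "e1 * M G \<preceq> e2 * u" "2 * (e1 * r G) \<preceq> e2 * u" "V G \<preceq> u"
    if "leg_bounds N G u" for G u i
  proof -
    have N: "N \<ge> 2" and G: "\<And>i. G i \<in> spos" and Gu: "\<And>i. G i \<preceq> u"
      and Mu: "e1 * (\<Sum>i<N. of_nat i * G i) \<preceq> e2 * u"
      using that by (auto simp: leg_bounds_def)
    show "G i \<in> spos" by (rule G)
    show u: "u \<in> spos" using G Gu spos_sle by blast
    show "d G \<in> spos" "r G \<in> spos" "M G \<in> spos" "z G \<in> spos" "V G \<in> spos"
      using G by (auto simp: d_def r_def M_def z_def V_def intro: spos_cst)
    show "d G = z G + r G"
      using N by (simp add: d_def z_def r_def sum_split_2)
    show "z G \<preceq> 2 * u"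
      unfolding z_def mult_2 by (intro sle_add Gu)
    have "M G \<preceq> (\<Sum>i<N. of_nat i * G i)"
      using N G by (simp add: sum_split_2 M_def sle_def)
    then have "e1 * M G \<preceq> e1 * (\<Sum>i<N. of_nat i * G i)"
      by (intro sle_mult_left) auto
    then show Mu': "e1 * M G \<preceq> e2 * u"
      using Mu sle_trans by blast
    have "(\<Sum>i=2..<N. 2 * G i) \<preceq> M G"
      unfolding M_def
    proof (intro sle_sum)
      fix i assume "i \<in> {2..<N}"
      then obtain i' where i: "i = 2 + i'"
        by (metis atLeastLessThan_iff le_Suc_ex)
      show "2 * G i \<preceq> of_nat i * G i"
        using G by (auto simp: i sle_def distrib_right)
    qed
    then have "2 * r G \<preceq> M G"
      by (simp add: r_def sum_distrib_left)
    then have "e1 * (2 * r G) \<preceq> e1 * M G"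
      by (intro sle_mult_left) auto
    then have "2 * (e1 * r G) \<preceq> e1 * M G"
      by (simp only: mult.left_commute)
    then show "2 * (e1 * r G) \<preceq> e2 * u"
      using Mu' by (rule sle_trans)
    have "V G \<preceq> (\<Sum>i=2..<N. cst (1 / (real i)\<^sup>2) * u)"
      unfolding V_def by (intro sle_sum sle_mult_left Gu spos_cst) auto
    also have "\<dots> = cst (\<Sum>i=2..<N. 1 / (real i)\<^sup>2) * u"
      by (simp add: sum_distrib_right [symmetric])
         (induction N, auto simp: atLeastLessThanSuc cst_def)
    also have "\<dots> \<preceq> u"
    proof -
      have "cst (1 - (\<Sum>i=2..<N. 1 / (real i)\<^sup>2)) * u \<in> spos"
        using sum_inverse_squares_le_1 [of N] u by (intro spos_cst_mult) auto
      also have "cst (1 - (\<Sum>i=2..<N. 1 / (real i)\<^sup>2)) * u = u - cst (\<Sum>i=2..<N. 1 / (real i)\<^sup>2) * u"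
        by (simp add: cst_diff left_diff_distrib)
      finally show ?thesis by (simp add: sle_def)
    qed
    finally show "V G \<preceq> u" .
  qed
  note P1 = props [OF assms(1)] and P2 = props [OF assms(2)] and P3 = props [OF assms(3)]
  note sp = P1(1-7) P2(1-7) P3(1-7)
  define A where "A = e1\<^sup>2 * e2 * (u1 * d G2 * d G3 + d G1 * u2 * d G3 + d G1 * d G2 * u3)"
  define B where "B = e1 * e2\<^sup>2 * (u1 * u2 * d G3 + d G1 * u2 * u3 + u1 * d G2 * u3)"
  define C where "C = e2 ^ 3 * (u1 * u2 * u3)"
  have A: "e2\<^sup>2 * (z G1 * d G2 * d G3 + d G1 * z G2 * d G3 + d G1 * d G2 * z G3) \<preceq> 2 * A"
  proof -
    have "e2\<^sup>2 * (z G1 * d G2 * d G3 + d G1 * z G2 * d G3 + d G1 * d G2 * z G3)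
      = (e2 * e2) * (z G1 * (d G2 * d G3) + z G2 * (d G1 * d G3) + z G3 * (d G1 * d G2))"
      by (simp add: power2_eq_square algebra_simps)
    also have "\<dots> \<preceq> (e2 * (e1 * e1)) * (2 * u1 * (d G2 * d G3) + 2 * u2 * (d G1 * d G3) + 2 * u3 * (d G1 * d G2))"
      by (rule sle_mult [OF sle_mult_left [OF e2_sle_e1_sq]])
         (intro sle_add sle_mult_right P1 P2 P3 spos_mult spos_add spos_e2 spos_e1 spos_numeral)+
    also have "\<dots> = 2 * A"
      by (simp add: A_def power2_eq_square algebra_simps)
    finally show ?thesis .
  qed
  \<comment> \<open>Of the two factors \<open>e1\<close> gained from one \<open>e2\<close>, one
    converts the tail \<open>r'\<close> into \<open>e2 * u'\<close> and the other remains as the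
    \<open>e1\<close> of \<open>B\<close>. The tail \<open>r''\<close> is merely enlarged to
    \<open>d'\<close>.\<close>
  have cross: "2 * (e2\<^sup>2 * (z' * r' * r'')) \<preceq> 2 * (e1 * e2\<^sup>2 * (u * u' * d'))"
    if "z' \<preceq> 2 * u" "2 * (e1 * r') \<preceq> e2 * u'" "r'' \<preceq> d'" "z' \<in> spos" "r' \<in> spos" "r'' \<in> spos" "u \<in> spos" "u' \<in> spos"
    for z' r' r'' u u' d' :: bipoly
  proof -
    have d': "d' \<in> spos" using that spos_sle by blast
    have "2 * (e2\<^sup>2 * (z' * r' * r'')) = (e2 * e2) * (2 * (z' * r' * r''))"
      by (simp add: power2_eq_square)
    also have "\<dots> \<preceq> (e2 * (e1 * e1)) * (2 * (z' * r' * r''))"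
      using that by (intro sle_mult_right sle_mult_left e2_sle_e1_sq) auto
    also have "\<dots> = (e1 * e2) * (z' * (2 * (e1 * r')) * r'')"
      by (simp add: mult_ac)
    also have "\<dots> \<preceq> (e1 * e2) * (2 * u * (e2 * u') * d')"
      by (intro sle_mult_left sle_mult [OF sle_mult [OF that(1,2)] that(3)]) (use that d' in auto)
    also have "\<dots> = 2 * (e1 * e2\<^sup>2 * (u * u' * d'))"
      by (simp add: power2_eq_square mult_ac)
    finally show ?thesis .
  qed
  have rd: "r G1 \<preceq> d G1" "r G2 \<preceq> d G2" "r G3 \<preceq> d G3"
    using P1(7,8) P2(7,8) P3(7,8) by (auto simp: sle_def)
  have B: "2 * (e2\<^sup>2 * (z G1 * r G2 * r G3 + r G1 * z G2 * r G3 + r G1 * r G2 * z G3)) \<preceq> 2 * B"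
  proof -
    have "2 * (e2\<^sup>2 * (z G1 * r G2 * r G3)) + 2 * (e2\<^sup>2 * (z G2 * r G3 * r G1)) + 2 * (e2\<^sup>2 * (z G3 * r G1 * r G2))
      \<preceq> 2 * (e1 * e2\<^sup>2 * (u1 * u2 * d G3)) + 2 * (e1 * e2\<^sup>2 * (u2 * u3 * d G1)) + 2 * (e1 * e2\<^sup>2 * (u3 * u1 * d G2))"
      by (intro sle_add cross P1 P2 P3 rd)
    also have "\<dots> = 2 * B"
      by (simp add: B_def algebra_simps)
    finally show ?thesis
      by (simp add: algebra_simps)
  qed
  \<comment> \<open>Two tails can be converted with the two available factors \<open>e1\<close>, but
    the third would have to be bounded by a fixed multiple of \<open>u\<close>, and its number of
    terms depends on \<open>N\<close>. The weighted sum \<open>V\<close> does satisfy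
    \<open>V G \<preceq> u\<close>, and \<open>weighted_tail_product\<close> replaces one tail by
    \<open>V\<close> and the other two by \<open>M\<close>.\<close>
  have C: "e2\<^sup>2 * (r G1 * r G2 * r G3) \<preceq> C"
  proof -
    have tail: "e2\<^sup>2 * (v * m * m') \<preceq> e2 ^ 3 * (u * u' * u'')"
      if "v \<preceq> u" "e1 * m \<preceq> e2 * u'" "e1 * m' \<preceq> e2 * u''" "v \<in> spos" "m \<in> spos" "m' \<in> spos" "u \<in> spos" "u' \<in> spos" "u'' \<in> spos"
      for v m m' u u' u'' :: bipoly
    proof -
      have "e2\<^sup>2 * (v * m * m') = (e2 * e2) * (v * m * m')"
        by (simp add: power2_eq_square)
      also have "\<dots> \<preceq> (e2 * (e1 * e1)) * (v * m * m')"
        using that by (intro sle_mult_right sle_mult_left e2_sle_e1_sq) auto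
      also have "\<dots> = e2 * (v * (e1 * m) * (e1 * m'))"
        by (simp add: mult_ac)
      also have "\<dots> \<preceq> e2 * (u * (e2 * u') * (e2 * u''))"
        by (intro sle_mult_left sle_mult [OF sle_mult [OF that(1,2)] that(3)]) (use that in auto)
      also have "\<dots> = e2 ^ 3 * (u * u' * u'')"
        by (simp add: power3_eq_cube mult_ac)
      finally show ?thesis .
    qed
    have "e2\<^sup>2 * (3 * (r G1 * r G2 * r G3)) \<preceq> e2\<^sup>2 * (V G1 * M G2 * M G3 + M G1 * V G2 * M G3 + M G1 * M G2 * V G3)"
      unfolding r_def V_def M_def
      by (intro sle_mult_left weighted_tail_product P1 P2 P3 spos_power spos_e2)
    also have "\<dots> = e2\<^sup>2 * (V G1 * M G2 * M G3) + e2\<^sup>2 * (V G2 * M G1 * M G3) + e2\<^sup>2 * (V G3 * M G1 * M G2)"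
      by (simp add: algebra_simps)
    also have "\<dots> \<preceq> e2 ^ 3 * (u1 * u2 * u3) + e2 ^ 3 * (u2 * u1 * u3) + e2 ^ 3 * (u3 * u1 * u2)"
      by (intro sle_add tail P1 P2 P3)
    finally have "cst (1 / 3) * (3 * (C - e2\<^sup>2 * (r G1 * r G2 * r G3))) \<in> spos"
      by (intro spos_cst_mult) (simp_all add: sle_def C_def algebra_simps)
    then show ?thesis
      by (simp add: sle_def numeral_cst mult.assoc [symmetric])
  qed
  \<comment> \<open>The added terms correct multiplicities: on substituting \<open>z + r\<close> for
    \<open>d\<close>, the bounds available count z z z and each z r r three times, but each z z r
    and r r r twice.\<close>
  have "2 * (e2\<^sup>2 * (d G1 * d G2 * d G3))
    \<preceq> 2 * (e2\<^sup>2 * (d G1 * d G2 * d G3)) + (e2\<^sup>2 * (z G1 * z G2 * z G3)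
       + e2\<^sup>2 * (z G1 * r G2 * r G3 + r G1 * z G2 * r G3 + r G1 * r G2 * z G3))"
    by (intro sle_add_spos spos_add spos_mult spos_power spos_e2 sp)
  also have "\<dots> = e2\<^sup>2 * (z G1 * d G2 * d G3 + d G1 * z G2 * d G3 + d G1 * d G2 * z G3)
    + 2 * (e2\<^sup>2 * (z G1 * r G2 * r G3 + r G1 * z G2 * r G3 + r G1 * r G2 * z G3))
    + 2 * (e2\<^sup>2 * (r G1 * r G2 * r G3))"
    unfolding P1(8) P2(8) P3(8) by (simp add: algebra_simps)
  also have "\<dots> \<preceq> 2 * A + 2 * B + 2 * C"
    by (intro sle_add A B sle_mult_left C spos_numeral)
  also have "\<dots> \<preceq> 2 * A + 2 * B + 2 * C + 2 * (e1 ^ 3 * (d G1 * d G2 * d G3))"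
    by (intro sle_add_spos spos_mult spos_power spos_e1 spos_numeral sp)
  also have "\<dots> = 2 * ((e1 * d G1 + e2 * u1) * (e1 * d G2 + e2 * u2) * (e1 * d G3 + e2 * u3))"
    by (simp add: A_def B_def C_def power2_eq_square power3_eq_cube algebra_simps)
  finally have "cst (1 / 2) * (2 * ((e1 * d G1 + e2 * u1) * (e1 * d G2 + e2 * u2) * (e1 * d G3 + e2 * u3)
      - e2\<^sup>2 * (d G1 * d G2 * d G3))) \<in> spos"
    by (intro spos_cst_mult) (simp_all add: sle_def right_diff_distrib)
  then show ?thesis
    by (simp add: sle_def numeral_cst mult.assoc [symmetric])
qed

lemma path_rest_triple:
  assumes "n1 \<ge> 1" "n2 \<ge> 1" "n3 \<ge> 1"
  shows "e2\<^sup>2 * (cross_poly n1 * cross_poly n2 * cross_poly n3) \<preceq> path_rest n1 * path_rest n2 * path_rest n3"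
proof -
  define N where "N = n1 + n2 + n3"
  have N: "n1 \<le> N" "n2 \<le> N" "n3 \<le> N" "2 \<le> N"
    using assms by (auto simp: N_def)
  \<comment> \<open>The summand \<open>e2 * cross_poly (n - 1)\<close> of \<open>path_rest\<close>
    is given away here.\<close>
  have le: "e1 * cross_poly n + e2 * path_sq (n - 1) \<preceq> path_rest n" for n
    by (auto simp: path_rest_def sle_def)
  have "e2\<^sup>2 * (cross_poly n1 * cross_poly n2 * cross_poly n3)
    \<preceq> (e1 * cross_poly n1 + e2 * path_sq (n1 - 1)) * (e1 * cross_poly n2 + e2 * path_sq (n2 - 1)) * (e1 * cross_poly n3 + e2 * path_sq (n3 - 1))"
    unfolding cross_poly_eq_sum_cross_term [OF N(1)] cross_poly_eq_sum_cross_term [OF N(2)] cross_poly_eq_sum_cross_term [OF N(3)]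
    by (intro leg_bounds_triple leg_bounds_cross_term N)
  also have "\<dots> \<preceq> path_rest n1 * path_rest n2 * path_rest n3"
    by (rule sle_mult [OF sle_mult [OF le le] le]) auto
  finally show ?thesis .
qed

section \<open>Combining the legs\<close>

text \<open>Apart from the factor \<open>e2\<close>, the left side is the power sum of exponent
  \<open>d + 2\<close>, and in two variables a power sum is h_k - e2 h_(k-2).\<close>

lemma power_sum_eq:
  "x2 * x1 ^ (d + 3) + x1 * x2 ^ (d + 3) = e2 * hsym (d + 2) - e2\<^sup>2 * hsym d"
proof -
  have pow: "t ^ Suc (d + 2) = t ^ d * t * t * t" "t ^ (d + 3) = t ^ d * t * t * t" "t ^ Suc d = t ^ d * t"
    for t :: bipoly
    by (simp_all add: eval_nat_numeral mult_ac)
  have "(x1 - x2) * (e2 * hsym (d + 2) - e2\<^sup>2 * hsym d)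
      = e2 * ((x1 - x2) * hsym (d + 2)) - e2\<^sup>2 * ((x1 - x2) * hsym d)"
    by (metis right_diff_distrib mult.left_commute)
  also have "\<dots> = (x1 - x2) * (x2 * x1 ^ (d + 3) + x1 * x2 ^ (d + 3))"
    unfolding x1_minus_x2_hsym pow e2_def power2_eq_square by (simp only: ring_distribs mult_ac)
  finally show ?thesis
    using eq_if_times_x1_minus_x2 by metis
qed

text \<open>Up to two legs the bracket itself is positive. From three on, any three legs absorb
  \<open>e2\<^sup>2\<close> by \<open>triple\<close>; the remaining \<open>d\<close> legs absorb
  \<open>hsym d\<close>, which is below \<open>e1 ^ d\<close>, by using \<open>single\<close> once
  per leg.\<close>

lemma subset_term_spos:
  fixes b r :: "'i \<Rightarrow> bipoly"
  assumes "finite S" and spos: "\<And>i. i \<in> S \<Longrightarrow> b i \<in> spos" "\<And>i. i \<in> S \<Longrightarrow> r i \<in> spos"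
    and single: "\<And>i. i \<in> S \<Longrightarrow> e1 * b i \<preceq> r i"
    and triple: "\<And>i j k. i \<in> S \<Longrightarrow> j \<in> S \<Longrightarrow> k \<in> S \<Longrightarrow> e2\<^sup>2 * (b i * b j * b k) \<preceq> r i * r j * r k"
  shows "prod r S + (x2 * x1 ^ card S + x1 * x2 ^ card S) * prod b S \<in> spos"
proof (cases "card S \<ge> 3")
  case False
  then consider "card S = 0" | "card S = 1" | "card S = 2"
    by linarith
  then have "x2 * x1 ^ card S + x1 * x2 ^ card S \<in> spos"
  proof cases
    case 1
    then show ?thesis using spos_e1 by (simp add: e1_def add.commute)
  next
    case 2
    have "2 * e2 \<in> spos" by (auto simp del: mult_2)
    then show ?thesis by (simp add: 2 e2_def mult_ac)
  next
    case 3
    have "e2 * e1 \<in> spos" by auto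
    then show ?thesis by (simp add: 3 e1_def e2_def power2_eq_square algebra_simps)
  qed
  with spos show ?thesis by auto
next
  case True
  then obtain T where T: "T \<subseteq> S" "card T = 3" "finite T"
    using obtain_subset_with_card_n finite_subset \<open>finite S\<close> by metis
  then obtain i j k where ijk: "T = {i, j, k}" "i \<noteq> j" "j \<noteq> k" "i \<noteq> k"
    by (auto simp: card_3_iff)
  define d where "d = card (S - T)"
  have d: "card S = d + 3"
    using T card_Diff_subset [of T S] card_mono [of S T] \<open>finite S\<close> by (simp add: d_def)
  have split: "prod f S = prod f T * prod f (S - T)" for f :: "'i \<Rightarrow> bipoly"
    using T \<open>finite S\<close> by (simp add: prod.subset_diff mult.commute)
  have "e2\<^sup>2 * hsym d * prod b S = (e2\<^sup>2 * prod b T) * (hsym d * prod b (S - T))"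
    by (simp add: split mult_ac)
  also have "\<dots> \<preceq> prod r T * (e1 ^ d * prod b (S - T))"
  proof (intro sle_mult sle_mult_right hsym_sle_e1_power)
    show "e2\<^sup>2 * prod b T \<preceq> prod r T"
      using triple [of i j k] ijk T by (simp add: mult.assoc)
  qed (use spos T in auto)
  also have "e1 ^ d * prod b (S - T) = (\<Prod>i\<in>S - T. e1 * b i)"
    by (simp add: prod.distrib d_def)
  also have "prod r T * \<dots> \<preceq> prod r T * prod r (S - T)"
    using spos single T by (intro sle_mult_left sle_prod) auto
  also have "\<dots> = prod r S"
    by (simp add: split)
  finally have "prod r S - e2\<^sup>2 * hsym d * prod b S \<in> spos"
    by (simp add: sle_def)
  moreover have "e2 * hsym (d + 2) * prod b S \<in> spos"
    using spos by auto
  ultimately have "(prod r S - e2\<^sup>2 * hsym d * prod b S) + e2 * hsym (d + 2) * prod b S \<in> spos"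
    by blast
  then show ?thesis
    unfolding d power_sum_eq by (simp add: algebra_simps)
qed

lemma prod_add_times:
  fixes a b :: "'i \<Rightarrow> 'a :: comm_semiring_1"
  assumes "finite I"
  shows "(\<Prod>i\<in>I. a i + t * b i) = (\<Sum>S\<in>Pow I. t ^ card S * prod b S * prod a (I - S))"
proof -
  have "(\<Prod>i\<in>I. a i + t * b i) = (\<Prod>i\<in>I. t * b i + a i)"
    by (simp add: add.commute)
  also have "\<dots> = (\<Sum>S\<in>Pow I. (\<Prod>i\<in>S. t * b i) * prod a (I - S))"
    by (rule prod_add [OF assms])
  also have "\<dots> = (\<Sum>S\<in>Pow I. t ^ card S * prod b S * prod a (I - S))"
    by (simp add: prod.distrib)
  finally show ?thesis .
qed

section \<open>Positivity for the whole spider\<close>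

definition spider_gf :: "nat list \<Rightarrow> 'a::comm_ring_1 \<Rightarrow> 'a" where
  "spider_gf lam t = (\<Prod>i<length lam. fibp (Suc (lam ! i)) t) + t * (\<Prod>i<length lam. fibp (lam ! i) t)"

lemma spider_gf_spos:
  assumes "0 \<notin> set lam"
  shows "spider_gf lam x1 * spider_gf lam x2 \<in> spos"
proof -
  define I where "I = {..<length lam}"
  have I: "finite I"
    by (simp add: I_def)
  have pos: "i \<in> I \<Longrightarrow> lam ! i \<ge> 1" for i
    using assms by (metis I_def One_nat_def Suc_leI gr0I lessThan_iff nth_mem)
  define a b r where "a i = cross_poly (Suc (lam ! i))" and "b i = cross_poly (lam ! i)" and "r i = path_rest (lam ! i)" for i
  let ?A = "\<lambda>t. \<Prod>i\<in>I. fibp (Suc (lam ! i)) t" and ?B = "\<lambda>t. \<Prod>i\<in>I. fibp (lam ! i) t"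
  have "?A x1 * ?A x2 + (x2 * (?A x1 * ?B x2) + x1 * (?A x2 * ?B x1))
      = (\<Prod>i\<in>I. r i + a i) + (x2 * (\<Prod>i\<in>I. a i + x1 * b i) + x1 * (\<Prod>i\<in>I. a i + x2 * b i))"
  proof -
    have "?A x1 * ?A x2 = (\<Prod>i\<in>I. r i + a i)"
      unfolding prod.distrib [symmetric] r_def a_def
      by (intro prod.cong refl) (use pos path_sq_Suc in \<open>simp add: path_sq_def add.commute\<close>)
    then show ?thesis
      by (simp only: prod.distrib [symmetric] fibp_cross a_def b_def)
  qed
  \<comment> \<open>The same \<open>a i\<close> occurs in the square and in both mixed products of a
    leg, so all three expansions run over the subsets \<open>S\<close> of legs with the common
    factor \<open>prod a (I - S)\<close>.\<close>
  also have "\<dots> = (\<Sum>S\<in>Pow I. prod a (I - S) * (prod r S + (x2 * x1 ^ card S + x1 * x2 ^ card S) * prod b S))"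
    unfolding prod_add_times [OF I] prod_add [OF I] sum_distrib_left sum.distrib [symmetric]
    by (intro sum.cong refl) (simp add: algebra_simps)
  also have "\<dots> \<in> spos"
  proof (intro spos_sum spos_mult subset_term_spos)
    fix S i
    assume "S \<in> Pow I" "i \<in> S"
    show "e1 * b i \<preceq> r i"
      by (auto simp: b_def r_def path_rest_def sle_def)
  next
    fix S i j k
    assume "S \<in> Pow I" "i \<in> S" "j \<in> S" "k \<in> S"
    then show "e2\<^sup>2 * (b i * b j * b k) \<preceq> r i * r j * r k"
      unfolding b_def r_def by (intro path_rest_triple pos) auto
  qed (use I finite_subset in \<open>auto simp: a_def b_def r_def\<close>)
  finally have "?A x1 * ?A x2 + (x2 * (?A x1 * ?B x2) + x1 * (?A x2 * ?B x1)) \<in> spos" .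
  moreover have "e2 * (?B x1 * ?B x2) \<in> spos"
    unfolding prod.distrib [symmetric] path_sq_def [symmetric] by auto
  ultimately have "?A x1 * ?A x2 + (x2 * (?A x1 * ?B x2) + x1 * (?A x2 * ?B x1))
      + e2 * (?B x1 * ?B x2) \<in> spos"
    by blast
  also have "?A x1 * ?A x2 + (x2 * (?A x1 * ?B x2) + x1 * (?A x2 * ?B x1)) + e2 * (?B x1 * ?B x2)
      = spider_gf lam x1 * spider_gf lam x2"
    by (simp add: spider_gf_def I_def e2_def algebra_simps)
  finally show ?thesis .
qed

text \<open>The coefficient of \<open>x1 ^ (n + 2) * x2 ^ (m + 1)\<close> in the product times
  \<open>x1 - x2\<close> is the difference of the two sides. It is the multiplicity of the Schur
  polynomial of (n + 1, m + 1).\<close>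

lemma coeff_log_concave:
  fixes c :: "nat \<Rightarrow> nat"
  assumes spos: "(\<Sum>k\<le>d. of_nat (c k) * x1 ^ k) * (\<Sum>k\<le>d. of_nat (c k) * x2 ^ k) \<in> spos"
    and zero: "\<And>k. k > d \<Longrightarrow> c k = 0" and "m \<le> n"
  shows "c m * c (Suc (Suc n)) \<le> c (Suc m) * c (Suc n)"
proof -
  let ?F = "(\<Sum>k\<le>d. of_nat (c k) * x1 ^ k) * (\<Sum>k\<le>d. of_nat (c k) * x2 ^ k)"
  have "(x1 - x2) * ?F = (\<Sum>k\<le>d. \<Sum>l\<le>d. (x1 - x2) * (of_nat (c k) * x1 ^ k * (of_nat (c l) * x2 ^ l)))"
    by (subst sum_product) (simp only: sum_distrib_left)
  also have "\<dots> = (\<Sum>k\<le>d. \<Sum>l\<le>d. cst (c k * c l) * (x1 ^ Suc k * x2 ^ l) - cst (c k * c l) * (x1 ^ k * x2 ^ Suc l))"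
    by (intro sum.cong refl) (simp add: of_nat_cst cst_simps(3) [symmetric] algebra_simps del: cst_simps)
  finally have eq: "(x1 - x2) * ?F = \<dots>" .
  have "0 \<le> coeff (coeff ((x1 - x2) * ?F) (Suc m)) (Suc (Suc n))"
    using spos \<open>m \<le> n\<close> by (intro spos_coeff_nonneg) auto
  also have "\<dots> = (\<Sum>k\<le>d. \<Sum>l\<le>d. (if k = Suc n then (if l = Suc m then real (c k * c l) else 0) else 0))
      - (\<Sum>k\<le>d. \<Sum>l\<le>d. (if k = Suc (Suc n) then (if l = m then real (c k * c l) else 0) else 0))"
    unfolding eq sum_subtractf [symmetric] coeff_sum coeff_diff coeff_cst_mult coeff_x1_power_x2_power
    by (intro sum.cong refl) auto
  also have "\<dots> = real (c (Suc n) * c (Suc m)) - real (c (Suc (Suc n)) * c m)"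
  proof -
    have delta: "(\<Sum>k\<le>d. \<Sum>l\<le>d. (if k = a then (if l = b then real (c k * c l) else 0) else 0)) = real (c a * c b)"
      for a b
    proof -
      have "(\<Sum>k\<le>d. \<Sum>l\<le>d. (if k = a then (if l = b then real (c k * c l) else 0) else 0))
        = (\<Sum>k\<le>d. if k = a then (\<Sum>l\<le>d. if l = b then real (c k * c l) else 0) else 0)"
        by (intro sum.cong refl) auto
      also have "\<dots> = real (c a * c b)"
        using zero [of a] zero [of b] by (auto simp: not_le)
      finally show ?thesis .
    qed
    show ?thesis by (simp only: delta)
  qed
  finally have "real (c (Suc (Suc n)) * c m) \<le> real (c (Suc n) * c (Suc m))"
    by simp
  then show ?thesis
    unfolding of_nat_le_iff by (simp add: mult.commute)
qed

section \<open>Independent sets of spiders\<close>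

text \<open>The lower end \<open>a\<close> is 0 for a full leg and 1 when the torso is chosen, which
  forbids the first vertex of every leg.\<close>

definition path_indep :: "nat \<Rightarrow> nat \<Rightarrow> nat set set" where
  "path_indep a b = {J. J \<subseteq> {a..<b} \<and> (\<forall>j\<in>J. Suc j \<notin> J)}"

lemma finite_path_indep [simp]: "finite (path_indep a b)"
  unfolding path_indep_def by simp

lemma finite_in_path_indep: "J \<in> path_indep a b \<Longrightarrow> finite J"
  unfolding path_indep_def using finite_subset by blast

text \<open>The case split is on the last vertex, so that the lower end stays fixed in the
  induction.\<close>

lemma path_indep_gf: "(\<Sum>J\<in>path_indep a (a + n). t ^ card J) = fibp (Suc n) t"
proof (induction n rule: induct_nat_012)
  case 0
  have "path_indep a (a + 0) = {{}}"
    by (auto simp: path_indep_def)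
  then show ?case by simp
next
  case 1
  have "path_indep a (a + Suc 0) = {{}, {a}}"
    by (auto simp: path_indep_def)
  then show ?case by simp
next
  case (ge2 n)
  let ?q = "a + Suc n"
  have eq: "path_indep a (a + Suc (Suc n)) = path_indep a (a + Suc n) \<union> insert ?q ` path_indep a (a + n)"
    (is "?L = ?R1 \<union> ?R2")
  proof (intro equalityI subsetI)
    fix J assume J: "J \<in> ?L"
    show "J \<in> ?R1 \<union> ?R2"
    proof (cases "?q \<in> J")
      case True
      with J have "J - {?q} \<in> path_indep a (a + n)"
        by (fastforce simp: path_indep_def less_Suc_eq)
      then have "insert ?q (J - {?q}) \<in> ?R2" by blast
      with True show ?thesis by (simp add: insert_absorb)
    next
      case False
      with J show ?thesis by (fastforce simp: path_indep_def less_Suc_eq)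
    qed
  qed (fastforce simp: path_indep_def)
  have disj: "?R1 \<inter> ?R2 = {}"
    by (fastforce simp: path_indep_def)
  have notin: "?q \<notin> J" if "J \<in> path_indep a (a + n)" for J
    using that by (auto simp: path_indep_def)
  have inj: "inj_on (insert ?q) (path_indep a (a + n))"
    using notin insert_ident by (metis (no_types, lifting) inj_onI)
  have card: "card (insert ?q J) = Suc (card J)" if "J \<in> path_indep a (a + n)" for J
    using that notin finite_in_path_indep by simp
  have "(\<Sum>J\<in>?L. t ^ card J) = (\<Sum>J\<in>?R1. t ^ card J) + (\<Sum>J\<in>path_indep a (a + n). t ^ card (insert ?q J))"
    unfolding eq by (subst sum.union_disjoint) (use disj inj in \<open>auto simp: sum.reindex\<close>)
  also have "(\<Sum>J\<in>path_indep a (a + n). t ^ card (insert ?q J)) = t * (\<Sum>J\<in>path_indep a (a + n). t ^ card J)"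
    unfolding sum_distrib_left by (intro sum.cong refl) (simp only: card power_Suc)
  finally show ?case using ge2 by simp
qed

definition leg_union :: "nat \<Rightarrow> (nat \<Rightarrow> nat set) \<Rightarrow> spider_vertex set" where
  "leg_union l g = {Leg i j | i j. i < l \<and> j \<in> g i}"

lemma leg_union_alt: "leg_union l g = (\<lambda>(i, j). Leg i j) ` (SIGMA i:{..<l}. g i)"
  by (auto simp: leg_union_def)

lemma finite_leg_union: "(\<And>i. i < l \<Longrightarrow> finite (g i)) \<Longrightarrow> finite (leg_union l g)"
  unfolding leg_union_alt by auto

lemma card_leg_union:
  assumes "\<And>i. i < l \<Longrightarrow> finite (g i)"
  shows "card (leg_union l g) = (\<Sum>i<l. card (g i))"
proof -
  have "inj_on (\<lambda>(i, j). Leg i j) (SIGMA i:{..<l}. g i)"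
    by (auto simp: inj_on_def)
  then show ?thesis
    unfolding leg_union_alt by (subst card_image) (use assms in \<open>auto simp: card_SigmaI\<close>)
qed

lemma inj_on_leg_union: "inj_on (leg_union l) (PiE {..<l} F)"
proof (rule inj_onI)
  fix g g' assume g: "g \<in> PiE {..<l} F" "g' \<in> PiE {..<l} F" and eq: "leg_union l g = leg_union l g'"
  have "j \<in> g i \<longleftrightarrow> Leg i j \<in> leg_union l g" "j \<in> g' i \<longleftrightarrow> Leg i j \<in> leg_union l g'" if "i < l" for i j
    using that by (auto simp: leg_union_def)
  then show "g = g'"
    using g eq by (intro PiE_ext [OF g]) auto
qed

lemma leg_family_gf:
  fixes t :: "'a :: comm_ring_1"
  shows "(\<Sum>g\<in>PiE {..<l} (\<lambda>i. path_indep a (b i)). t ^ card (leg_union l g))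
    = (\<Prod>i<l. \<Sum>J\<in>path_indep a (b i). t ^ card J)"
proof -
  have "(\<Prod>i<l. \<Sum>J\<in>path_indep a (b i). t ^ card J)
      = (\<Sum>g\<in>PiE {..<l} (\<lambda>i. path_indep a (b i)). \<Prod>i<l. t ^ card (g i))"
    by (intro prod_sum_PiE) auto
  also have "\<dots> = (\<Sum>g\<in>PiE {..<l} (\<lambda>i. path_indep a (b i)). t ^ card (leg_union l g))"
  proof (intro sum.cong refl)
    fix g assume "g \<in> PiE {..<l} (\<lambda>i. path_indep a (b i))"
    then have "card (leg_union l g) = (\<Sum>i<l. card (g i))"
      using finite_in_path_indep by (intro card_leg_union) (auto simp: PiE_def Pi_def)
    then show "(\<Prod>i<l. t ^ card (g i)) = t ^ card (leg_union l g)"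
      by (simp add: power_sum)
  qed
  finally show ?thesis ..
qed

lemma spider_edges:
  "{Torso} \<notin> edges (spider lam)"
  "{Torso, Leg i j} \<in> edges (spider lam) \<longleftrightarrow> i < length lam \<and> 0 < lam ! i \<and> j = 0"
  "{Leg i j, Torso} \<in> edges (spider lam) \<longleftrightarrow> i < length lam \<and> 0 < lam ! i \<and> j = 0"
  "{Leg i j, Leg i' j'} \<in> edges (spider lam) \<longleftrightarrow>
     i = i' \<and> i < length lam \<and> (j' = Suc j \<and> j' < lam ! i \<or> j = Suc j' \<and> j < lam ! i)"
  by (auto simp: spider_def doubleton_eq_iff)

lemma spider_verts:
  "Torso \<in> verts (spider lam)" "Leg i j \<in> verts (spider lam) \<longleftrightarrow> i < length lam \<and> j < lam ! i"
  by (auto simp: spider_def)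

lemma independent_spider_iff:
  "independent (spider lam) S \<longleftrightarrow>
     (\<forall>i j. Leg i j \<in> S \<longrightarrow> i < length lam \<and> j < lam ! i \<and> Leg i (Suc j) \<notin> S \<and> (Torso \<in> S \<longrightarrow> j \<noteq> 0))"
proof
  assume ind: "independent (spider lam) S"
  show "\<forall>i j. Leg i j \<in> S \<longrightarrow> i < length lam \<and> j < lam ! i \<and> Leg i (Suc j) \<notin> S \<and> (Torso \<in> S \<longrightarrow> j \<noteq> 0)"
  proof (intro allI impI)
    fix i j assume ij: "Leg i j \<in> S"
    then have "Leg i j \<in> verts (spider lam)" using ind by (auto simp: independent_def)
    then have v: "i < length lam" "j < lam ! i" by (auto simp: spider_verts)
    have "Leg i (Suc j) \<notin> S"
    proof
      assume "Leg i (Suc j) \<in> S"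
      then have "Leg i (Suc j) \<in> verts (spider lam)" "{Leg i j, Leg i (Suc j)} \<notin> edges (spider lam)"
        using ind ij by (auto simp: independent_def)
      then show False by (auto simp: spider_verts spider_edges)
    qed
    moreover have "j \<noteq> 0" if "Torso \<in> S"
    proof -
      have "{Torso, Leg i j} \<notin> edges (spider lam)"
        using ind ij that by (simp add: independent_def)
      with v show ?thesis by (auto simp: spider_edges)
    qed
    ultimately show "i < length lam \<and> j < lam ! i \<and> Leg i (Suc j) \<notin> S \<and> (Torso \<in> S \<longrightarrow> j \<noteq> 0)"
      using v by auto
  qed
next
  assume *: "\<forall>i j. Leg i j \<in> S \<longrightarrow> i < length lam \<and> j < lam ! i \<and> Leg i (Suc j) \<notin> S \<and> (Torso \<in> S \<longrightarrow> j \<noteq> 0)"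
  have "u \<in> verts (spider lam)" if "u \<in> S" for u
    using * that by (cases u) (auto simp: spider_verts)
  moreover have "{u, v} \<notin> edges (spider lam)" if "u \<in> S" "v \<in> S" for u v
    using * that by (cases u; cases v) (auto simp: spider_edges)
  ultimately show "independent (spider lam) S"
    by (auto simp: independent_def)
qed

lemma independent_spider:
  "{S. independent (spider lam) S} =
     leg_union (length lam) ` PiE {..<length lam} (\<lambda>i. path_indep 0 (lam ! i)) \<union>
     (\<lambda>g. insert Torso (leg_union (length lam) g)) ` PiE {..<length lam} (\<lambda>i. path_indep 1 (lam ! i))"
  (is "?L = ?R1 \<union> ?R2")
proof (intro equalityI subsetI)
  fix S assume "S \<in> ?L"
  then have ind: "i < length lam" "j < lam ! i" "Leg i (Suc j) \<notin> S" "Torso \<in> S \<Longrightarrow> j \<noteq> 0" if "Leg i j \<in> S" for i j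
    using that unfolding independent_spider_iff by blast+
  define g where "g = restrict (\<lambda>i. {j. Leg i j \<in> S}) {..<length lam}"
  have union: "Leg i j \<in> leg_union (length lam) g \<longleftrightarrow> Leg i j \<in> S" "Torso \<notin> leg_union (length lam) g" for i j
    using ind by (auto simp: leg_union_def g_def)
  show "S \<in> ?R1 \<union> ?R2"
  proof (cases "Torso \<in> S")
    case True
    have "S = insert Torso (leg_union (length lam) g)"
    proof (rule set_eqI)
      fix v show "v \<in> S \<longleftrightarrow> v \<in> insert Torso (leg_union (length lam) g)"
        using True union by (cases v) auto
    qed
    moreover have "g \<in> PiE {..<length lam} (\<lambda>i. path_indep 1 (lam ! i))"
      using ind True by (auto simp: g_def path_indep_def Suc_le_eq)
    ultimately show ?thesis by blast
  next
    case False
    have "S = leg_union (length lam) g"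
    proof (rule set_eqI)
      fix v show "v \<in> S \<longleftrightarrow> v \<in> leg_union (length lam) g"
        using False union by (cases v) auto
    qed
    moreover have "g \<in> PiE {..<length lam} (\<lambda>i. path_indep 0 (lam ! i))"
      using ind by (auto simp: g_def path_indep_def)
    ultimately show ?thesis by blast
  qed
next
  fix S assume "S \<in> ?R1 \<union> ?R2"
  then show "S \<in> ?L"
    by (fastforce simp: independent_spider_iff leg_union_def path_indep_def PiE_def Pi_def)
qed

lemma spider_indep_gf:
  fixes t :: "'a :: comm_ring_1"
  assumes "0 \<notin> set lam"
  shows "(\<Sum>S | independent (spider lam) S. t ^ card S) = spider_gf lam t"
proof -
  let ?l = "length lam"
  let ?P = "\<lambda>a. PiE {..<?l} (\<lambda>i. path_indep a (lam ! i))"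
  have fin: "finite (?P a)" for a
    by (intro finite_PiE) auto
  have Torso: "Torso \<notin> leg_union ?l g" for g
    by (auto simp: leg_union_def)
  have inj: "inj_on (\<lambda>g. insert Torso (leg_union ?l g)) (?P 1)"
  proof (rule inj_onI)
    fix g g' assume "g \<in> ?P 1" "g' \<in> ?P 1"
      "insert Torso (leg_union ?l g) = insert Torso (leg_union ?l g')"
    then show "g = g'"
      using inj_onD [OF inj_on_leg_union] Torso insert_ident by metis
  qed
  have card: "card (insert Torso (leg_union ?l g)) = Suc (card (leg_union ?l g))" if "g \<in> ?P 1" for g
  proof -
    have "finite (leg_union ?l g)"
      using that finite_in_path_indep by (intro finite_leg_union) (auto simp: PiE_def Pi_def)
    then show ?thesis using Torso by simp
  qed
  have "(\<Sum>S | independent (spider lam) S. t ^ card S)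
      = (\<Sum>S\<in>leg_union ?l ` ?P 0. t ^ card S) + (\<Sum>S\<in>(\<lambda>g. insert Torso (leg_union ?l g)) ` ?P 1. t ^ card S)"
    unfolding independent_spider
  proof (rule sum.union_disjoint)
    show "leg_union ?l ` ?P 0 \<inter> (\<lambda>g. insert Torso (leg_union ?l g)) ` ?P 1 = {}"
      using Torso by (metis (no_types, lifting) disjoint_iff imageE insertI1)
  qed (use fin in auto)
  also have "(\<Sum>S\<in>leg_union ?l ` ?P 0. t ^ card S) = (\<Sum>g\<in>?P 0. t ^ card (leg_union ?l g))"
    by (simp add: sum.reindex inj_on_leg_union)
  also have "\<dots> = (\<Prod>i<?l. fibp (Suc (lam ! i)) t)"
    unfolding leg_family_gf using path_indep_gf [where a = 0 and t = t] by simp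
  also have "(\<Sum>S\<in>(\<lambda>g. insert Torso (leg_union ?l g)) ` ?P 1. t ^ card S) = t * (\<Sum>g\<in>?P 1. t ^ card (leg_union ?l g))"
    unfolding sum.reindex [OF inj] sum_distrib_left
    by (intro sum.cong refl) (simp only: o_def card power_Suc)
  also have "(\<Sum>g\<in>?P 1. t ^ card (leg_union ?l g)) = (\<Prod>i<?l. fibp (lam ! i) t)"
    unfolding leg_family_gf
  proof (intro prod.cong refl)
    fix i assume "i \<in> {..<?l}"
    then obtain n where "lam ! i = Suc n"
      using assms by (metis lessThan_iff nth_mem not0_implies_Suc)
    then show "(\<Sum>J\<in>path_indep 1 (lam ! i). t ^ card J) = fibp (lam ! i) t"
      using path_indep_gf [where a = 1 and n = n and t = t] by simp
  qed
  finally show ?thesis by (simp add: spider_gf_def)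
qed

section \<open>From generating functions to counts, and log-concavity\<close>

lemma finite_independent: "simple_graph G \<Longrightarrow> finite {S. independent G S}"
  unfolding independent_def simple_graph_def by (rule finite_subset [of _ "Pow (verts G)"]) auto

lemma indep_count_eq_0:
  assumes "simple_graph G" "k > card (verts G)"
  shows "indep_count G k = 0"
proof -
  have "\<not> independent G S" if "card S = k" for S
    using assms that card_mono [of "verts G" S] by (auto simp: independent_def simple_graph_def)
  then have "{S. independent G S \<and> card S = k} = {}" by blast
  then show ?thesis by (simp only: indep_count_def card.empty)
qed

lemma indep_gf_eq_sum_count:
  fixes t :: "'a :: comm_ring_1"
  assumes G: "simple_graph G"
  shows "(\<Sum>S | independent G S. t ^ card S) = (\<Sum>k\<le>card (verts G). of_nat (indep_count G k) * t ^ k)"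
proof -
  have "card S \<le> card (verts G)" if "independent G S" for S
    using G that by (auto simp: independent_def simple_graph_def intro: card_mono)
  then have "(\<Sum>S | independent G S. t ^ card S)
      = (\<Sum>k\<le>card (verts G). \<Sum>S | S \<in> {S. independent G S} \<and> card S = k. t ^ card S)"
    by (intro sum.group [symmetric] finite_independent [OF G]) auto
  also have "\<dots> = (\<Sum>k\<le>card (verts G). of_nat (indep_count G k) * t ^ k)"
    by (intro sum.cong refl) (simp add: indep_count_def)
  finally show ?thesis .
qed

lemma indep_count_spider_adjacent:
  assumes "0 \<notin> set lam" "m \<le> n"
  defines "c \<equiv> indep_count (spider lam)"
  shows "c m * c (Suc (Suc n)) \<le> c (Suc m) * c (Suc n)"
proof (rule coeff_log_concave)
  let ?d = "card (verts (spider lam))"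
  have "(\<Sum>k\<le>?d. of_nat (c k) * t ^ k) = spider_gf lam t" for t :: bipoly
    unfolding c_def spider_indep_gf [OF assms(1), symmetric] indep_gf_eq_sum_count [OF simple_graph_spider] ..
  then show "(\<Sum>k\<le>?d. of_nat (c k) * x1 ^ k) * (\<Sum>k\<le>?d. of_nat (c k) * x2 ^ k) \<in> spos"
    using spider_gf_spos [OF assms(1)] by simp
  show "c k = 0" if "k > ?d" for k
    using that simple_graph_spider unfolding c_def by (rule indep_count_eq_0 [rotated])
qed fact

text \<open>The pair (m, n) is spread to (p, q) one unit at a time. Since the adjacent inequality is
  available for every m \<le> n and not just for m = n, the steps chain without dividing by
  counts.\<close>

lemma indep_count_spider_log_concave:
  assumes "0 \<notin> set lam" "p < m" "m \<le> n" "m + n = p + q"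
  defines "c \<equiv> indep_count (spider lam)"
  shows "c p * c q \<le> c m * c n"
proof -
  have "c (m - k) * c (n + k) \<le> c m * c n" if "k \<le> m" for k
    using that
  proof (induction k)
    case (Suc k)
    define m' n' where "m' = m - Suc k" and "n' = n + k - 1"
    have "m - k = Suc m'" "n + k = Suc n'" "n + Suc k = Suc (Suc n')" "m' \<le> n'"
      using Suc.prems \<open>m \<le> n\<close> by (auto simp: m'_def n'_def)
    then show ?case
      using Suc indep_count_spider_adjacent [OF assms(1), of m' n']
      unfolding c_def m'_def [symmetric] by simp
  qed simp
  moreover have "m - (m - p) = p" "n + (m - p) = q"
    using assms by auto
  ultimately show ?thesis
    by (metis diff_le_self)
qed

lemma coeff_indep_poly:
  assumes "simple_graph G"
  shows "coeff (indep_poly G) k = int (indep_count G k)"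
proof (cases "k \<le> indep_number G")
  case False
  have "card S \<le> indep_number G" if "independent G S" for S
    unfolding indep_number_def using that finite_independent [OF assms] by (intro Max_ge) auto
  then have "{S. independent G S \<and> card S = k} = {}"
    using False by auto
  then have "indep_count G k = 0"
    by (simp only: indep_count_def card.empty)
  then show ?thesis
    using False by (simp add: indep_poly_def coeff_sum coeff_monom)
qed (simp add: indep_poly_def coeff_sum coeff_monom)

lemma spider_strongly_log_concave:
  assumes "0 \<notin> set lam"
  shows "strongly_log_concave (indep_poly (spider lam))"
  unfolding strongly_log_concave_def coeff_indep_poly [OF simple_graph_spider] of_nat_mult [symmetric]
    of_nat_le_iff
  using indep_count_spider_log_concave [OF assms] by blast

section \<open>The Bender-Knuth involution\<close>

text \<open>Contents are plain functions, so that exchanging two of their values is a function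
  update; \<open>monomial\<close> returns only when Schur coefficients are read off.\<close>

definition tabs :: "nat list \<Rightarrow> (nat \<Rightarrow> nat) \<Rightarrow> (nat \<times> nat \<Rightarrow> nat) set" where
  "tabs lam w = {T. ssyt lam T \<and> (\<forall>k. w k = card {c \<in> cells lam. T c = k})}"

definition kostka :: "nat list \<Rightarrow> (nat \<Rightarrow> nat) \<Rightarrow> nat" where
  "kostka lam w = card (tabs lam w)"

lemma schur_eq_kostka: "schur lam m = int (kostka lam (Poly_Mapping.lookup m))"
  by (simp add: schur_def kostka_def tabs_def)

lemma cells_iff: "(i, j) \<in> cells lam \<longleftrightarrow> i < length lam \<and> j < lam ! i"
  by (simp add: cells_def)

lemma cells_Sigma: "cells lam = (SIGMA i:{..<length lam}. {..<lam ! i})"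
  by (auto simp: cells_def)

lemma finite_cells [simp]: "finite (cells lam)"
  by (simp add: cells_Sigma)

lemma card_cells: "card (cells lam) = sum_list lam"
  by (simp add: cells_Sigma sum_list_sum_nth atLeast0LessThan)

lemma cells_left: "(i, j) \<in> cells lam \<Longrightarrow> j' \<le> j \<Longrightarrow> (i, j') \<in> cells lam"
  by (simp add: cells_iff)

lemma cells_up:
  assumes "is_partition lam" "(Suc i, j) \<in> cells lam"
  shows "(i, j) \<in> cells lam"
proof -
  have "lam ! Suc i \<le> lam ! i"
    using assms by (auto simp: is_partition_def cells_iff sorted_wrt_iff_nth_less)
  then show ?thesis using assms(2) by (simp add: cells_iff)
qed

lemma ssyt_ge_1: "ssyt lam T \<Longrightarrow> c \<in> cells lam \<Longrightarrow> T c \<ge> 1"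
  unfolding ssyt_def by (metis PiE_mem atLeast_iff)

lemma ssyt_row_step: "ssyt lam T \<Longrightarrow> (i, Suc j) \<in> cells lam \<Longrightarrow> T (i, j) \<le> T (i, Suc j)"
  unfolding ssyt_def by blast

lemma ssyt_col_step: "ssyt lam T \<Longrightarrow> (Suc i, j) \<in> cells lam \<Longrightarrow> T (i, j) < T (Suc i, j)"
  unfolding ssyt_def by blast

lemma ssyt_row:
  assumes "ssyt lam T" "(i, j') \<in> cells lam" "j \<le> j'"
  shows "T (i, j) \<le> T (i, j')"
  using assms(3,2)
proof (induction j' rule: dec_induct)
  case (step n)
  then have "T (i, j) \<le> T (i, n)" using cells_left [of i "Suc n" lam n] by simp
  also have "\<dots> \<le> T (i, Suc n)" using assms(1) step.prems by (rule ssyt_row_step)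
  finally show ?case .
qed simp

lemma ssyt_ge_row:
  assumes "is_partition lam" "ssyt lam T" "(i, j) \<in> cells lam"
  shows "T (i, j) \<ge> Suc i"
  using assms(3)
proof (induction i)
  case 0
  then show ?case using ssyt_ge_1 assms(2) by auto
next
  case (Suc i)
  then have "(i, j) \<in> cells lam" using cells_up assms(1) by blast
  then have "T (i, j) \<ge> Suc i" by (rule Suc.IH)
  moreover have "T (i, j) < T (Suc i, j)" using assms(2) Suc.prems by (rule ssyt_col_step)
  ultimately show ?case by simp
qed

lemma down_closed_eq_lessThan:
  assumes "finite (D :: nat set)" "\<And>a b. b \<in> D \<Longrightarrow> a \<le> b \<Longrightarrow> a \<in> D"
  shows "D = {..<card D}"
proof (cases "D = {}")
  case False
  then have "Max D \<in> D" using assms(1) by simp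
  then have "D = {..Max D}"
    using assms(2) [OF \<open>Max D \<in> D\<close>] Max_ge [OF assms(1)] by auto
  then show ?thesis
    by (metis card_atMost lessThan_Suc_atMost)
qed simp

text \<open>For fixed \<open>k\<close> these are the row lengths of the subshape of entries below
  \<open>k\<close>; over all \<open>k\<close> they form the Gelfand-Tsetlin pattern of the tableau.
  A Bender-Knuth move changes the single layer \<open>k + 1\<close> of it.\<close>

definition row_count :: "nat list \<Rightarrow> (nat \<times> nat \<Rightarrow> nat) \<Rightarrow> nat \<Rightarrow> nat \<Rightarrow> nat" where
  "row_count lam T k i = card {j. (i, j) \<in> cells lam \<and> T (i, j) < k}"

lemma less_row_count_iff:
  assumes "ssyt lam T"
  shows "j < row_count lam T k i \<longleftrightarrow> (i, j) \<in> cells lam \<and> T (i, j) < k"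
proof -
  let ?D = "{j. (i, j) \<in> cells lam \<and> T (i, j) < k}"
  have "finite ?D"
    by (rule finite_subset [of _ "{..<lam ! i}"]) (auto simp: cells_iff)
  then have "?D = {..<card ?D}"
  proof (rule down_closed_eq_lessThan)
    fix a b assume "b \<in> ?D" "a \<le> b"
    then show "a \<in> ?D"
      using cells_left [of i b lam a] ssyt_row [OF assms, of i b a] by auto
  qed
  from arg_cong [OF this, of "\<lambda>S. j \<in> S"] show ?thesis
    by (simp add: row_count_def)
qed

lemma row_count_unique:
  assumes "\<And>j. j < a \<longleftrightarrow> (i, j) \<in> cells lam \<and> T (i, j) < k"
  shows "row_count lam T k i = a"
proof -
  have "{j. (i, j) \<in> cells lam \<and> T (i, j) < k} = {..<a}"
    using assms by auto
  then show ?thesis by (simp add: row_count_def)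
qed

context
  fixes lam :: "nat list" and k :: nat
begin

text \<open>These are the interlacing conditions. Entries below \<open>k\<close> stay in place and
  entries above \<open>k + 1\<close> are out of reach, while column strictness puts an entry at most
  \<open>k\<close> above each entry at most \<open>k + 1\<close>, and an entry below
  \<open>k\<close> above each entry at most \<open>k\<close>. Row 0 has no row above it.\<close>

abbreviation (input) "bk_lo T i \<equiv> max (row_count lam T k i) (row_count lam T (k + 2) (Suc i))"

abbreviation (input) "bk_hi T i \<equiv>
  (if i = 0 then row_count lam T (k + 2) 0 else min (row_count lam T (k + 2) i) (row_count lam T k (i - 1)))"

text \<open>With all other entries fixed, the number of entries \<open>\<le> k\<close> in row \<open>i\<close> ranges exactly over
  \<open>{bk_lo T i..bk_hi T i}\<close>; the involution reflects this interval in every row.\<close>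

definition bk_mid :: "(nat \<times> nat \<Rightarrow> nat) \<Rightarrow> nat \<Rightarrow> nat" where
  "bk_mid T i = bk_lo T i + bk_hi T i - row_count lam T (k + 1) i"

definition bender_knuth :: "(nat \<times> nat \<Rightarrow> nat) \<Rightarrow> nat \<times> nat \<Rightarrow> nat" where
  "bender_knuth T = (\<lambda>(i, j). if (i, j) \<in> cells lam \<and> T (i, j) \<in> {k, k + 1}
     then if j < bk_mid T i then k else k + 1 else T (i, j))"

context
  fixes T :: "nat \<times> nat \<Rightarrow> nat"
  assumes lam: "is_partition lam" and k: "k \<ge> 1" and T: "ssyt lam T"
begin

lemma row_count_mono: "a \<le> b \<Longrightarrow> row_count lam T a i \<le> row_count lam T b i"
  by (metis less_row_count_iff [OF T] not_le_imp_less order.strict_trans2 less_irrefl)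

lemma row_count_Suc_row: "row_count lam T (Suc a) (Suc i) \<le> row_count lam T a i"
proof (rule ccontr)
  assume "\<not> ?thesis"
  then have "(Suc i, row_count lam T a i) \<in> cells lam" "T (Suc i, row_count lam T a i) < Suc a"
    using less_row_count_iff [OF T, of "row_count lam T a i" "Suc a" "Suc i"] by auto
  moreover from this have "(i, row_count lam T a i) \<in> cells lam"
    "T (i, row_count lam T a i) < T (Suc i, row_count lam T a i)"
    using cells_up [OF lam] ssyt_col_step [OF T] by auto
  ultimately show False
    using less_row_count_iff [OF T, of "row_count lam T a i" a i] by auto
qed

lemma bk_bounds:
  "bk_lo T i \<le> row_count lam T (k + 1) i" "row_count lam T (k + 1) i \<le> bk_hi T i"
  "bk_lo T i \<le> bk_mid T i" "bk_mid T i \<le> bk_hi T i"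
proof -
  show 1: "bk_lo T i \<le> row_count lam T (k + 1) i"
    using row_count_mono [of k "k + 1" i] row_count_Suc_row [of "k + 1" i] by simp
  show 2: "row_count lam T (k + 1) i \<le> bk_hi T i"
    using row_count_mono [of "k + 1" "k + 2" i] row_count_Suc_row [of k "i - 1"] by auto
  show "bk_lo T i \<le> bk_mid T i" "bk_mid T i \<le> bk_hi T i"
    using 1 2 unfolding bk_mid_def by linarith+
qed

text \<open>Comparisons with thresholds determine a tableau, and only the threshold
  \<open>k + 1\<close> changes; semistandardness, row counts and content are all derived from
  this.\<close>

lemma bk_less_iff:
  assumes "(i, j) \<in> cells lam"
  shows "bender_knuth T (i, j) < a \<longleftrightarrow> (if a = k + 1 then j < bk_mid T i else T (i, j) < a)"
proof -
  have "j < row_count lam T k i \<longleftrightarrow> T (i, j) < k" "j < row_count lam T (k + 2) i \<longleftrightarrow> T (i, j) < k + 2"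
    using less_row_count_iff [OF T] assms by auto
  moreover have "row_count lam T k i \<le> bk_mid T i" "bk_mid T i \<le> row_count lam T (k + 2) i"
    using bk_bounds(3,4) [of i] by (auto split: if_splits)
  ultimately show ?thesis
    using assms by (auto simp: bender_knuth_def)
qed

lemma ssyt_bk: "ssyt lam (bender_knuth T)"
proof -
  have "bender_knuth T \<in> cells lam \<rightarrow>\<^sub>E {1..}"
    using T k by (auto simp: bender_knuth_def ssyt_def PiE_def Pi_def extensional_def)
  moreover have "bender_knuth T (i, j) \<le> bender_knuth T (i, Suc j)" if cell: "(i, Suc j) \<in> cells lam" for i j
  proof (rule ccontr)
    assume "\<not> ?thesis"
    then have "bender_knuth T (i, Suc j) < bender_knuth T (i, j)" by simp
    moreover have "T (i, j) \<le> T (i, Suc j)" using ssyt_row [OF T cell] by simp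
    moreover have "(i, j) \<in> cells lam" using cells_left [OF cell] by simp
    ultimately show False
      using bk_less_iff [OF cell, of "bender_knuth T (i, j)"] bk_less_iff [of i j "bender_knuth T (i, j)"]
      by (auto split: if_splits)
  qed
  moreover have "bender_knuth T (i, j) < bender_knuth T (Suc i, j)" if cell: "(Suc i, j) \<in> cells lam" for i j
  proof -
    define b where "b = bender_knuth T (Suc i, j)"
    have cell': "(i, j) \<in> cells lam" using cells_up [OF lam cell] .
    have less: "T (i, j) < T (Suc i, j)" using T cell by (rule ssyt_col_step)
    have mid: "bk_mid T (Suc i) \<le> row_count lam T k i" "row_count lam T (k + 2) (Suc i) \<le> bk_mid T i"
      using bk_bounds(3) [of i] bk_bounds(4) [of "Suc i"] by auto
    show ?thesis
    proof (cases "b = k \<or> b = k + 1")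
      case False
      then have "T (Suc i, j) = b"
        by (auto simp: b_def bender_knuth_def split: if_splits)
      then show ?thesis
        using False less bk_less_iff [OF cell', of b] by (auto simp: b_def)
    next
      case True
      then show ?thesis
      proof
        assume "b = k"
        then have "j < bk_mid T (Suc i)"
          using bk_less_iff [OF cell, of "k + 1"] by (simp add: b_def)
        then have "T (i, j) < k"
          using mid(1) less_row_count_iff [OF T, of j k i] by auto
        then show ?thesis
          using \<open>b = k\<close> bk_less_iff [OF cell', of k] by (simp add: b_def)
      next
        assume "b = k + 1"
        then have "T (Suc i, j) < k + 2"
          using bk_less_iff [OF cell, of "k + 2"] by (simp add: b_def)
        then have "j < bk_mid T i"
          using mid(2) less_row_count_iff [OF T, of j "k + 2" "Suc i"] cell by auto
        then show ?thesis
          using \<open>b = k + 1\<close> bk_less_iff [OF cell', of "k + 1"] by (simp add: b_def)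
      qed
    qed
  qed
  ultimately show ?thesis by (simp add: ssyt_def)
qed

lemma row_count_bk:
  "row_count lam (bender_knuth T) a i = (if a = k + 1 then bk_mid T i else row_count lam T a i)"
proof (rule row_count_unique)
  fix j
  have "(i, j) \<in> cells lam" if "j < bk_mid T i"
    using that bk_bounds(4) [of i] less_row_count_iff [OF T, of j "k + 2" i] by (auto split: if_splits)
  then show "j < (if a = k + 1 then bk_mid T i else row_count lam T a i) \<longleftrightarrow>
      (i, j) \<in> cells lam \<and> bender_knuth T (i, j) < a"
    using bk_less_iff [of i j a] less_row_count_iff [OF T, of j a i] by auto
qed

text \<open>The interval depends on the layers \<open>k\<close> and \<open>k + 2\<close> only, which
  the move preserves, so a second reflection undoes the first.\<close>

lemma bk_mid_bk: "bk_mid (bender_knuth T) i = row_count lam T (k + 1) i"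
proof -
  have "bk_mid (bender_knuth T) i = bk_lo T i + bk_hi T i - bk_mid T i"
    by (simp add: bk_mid_def [of "bender_knuth T"] row_count_bk)
  also have "\<dots> = row_count lam T (k + 1) i"
    using bk_bounds(1,2) [of i] unfolding bk_mid_def by linarith
  finally show ?thesis .
qed

lemma bk_involution: "bender_knuth (bender_knuth T) = T"
proof
  fix c :: "nat \<times> nat"
  obtain i j where c: "c = (i, j)" by (cases c)
  show "bender_knuth (bender_knuth T) c = T c"
  proof (cases "(i, j) \<in> cells lam \<and> T (i, j) \<in> {k, k + 1}")
    case True
    then have "bender_knuth T (i, j) \<in> {k, k + 1}" by (simp add: bender_knuth_def)
    then have "bender_knuth (bender_knuth T) (i, j) = (if j < row_count lam T (k + 1) i then k else k + 1)"
      unfolding bender_knuth_def [of "bender_knuth T"] using True by (simp add: bk_mid_bk)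
    also have "\<dots> = T (i, j)"
      using True by (auto simp: less_row_count_iff [OF T])
    finally show ?thesis by (simp add: c)
  next
    case False
    then have "bender_knuth T (i, j) = T (i, j)" by (auto simp: bender_knuth_def)
    then show ?thesis using False by (auto simp: c bender_knuth_def [of "bender_knuth T"])
  qed
qed

end

lemma card_entries:
  assumes "ssyt lam T"
  shows "card {c \<in> cells lam. T c = a} = (\<Sum>i<length lam. row_count lam T (Suc a) i - row_count lam T a i)"
proof -
  have "{c \<in> cells lam. T c = a} = (SIGMA i:{..<length lam}. {row_count lam T a i..<row_count lam T (Suc a) i})"
    by (auto simp: less_row_count_iff [OF assms] not_less [symmetric] cells_iff)
  then show ?thesis by simp
qed

text \<open>The lower end in row \<open>i\<close> and the upper end in row \<open>Suc i\<close> are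
  the maximum and the minimum of the same two numbers. Only the upper end in row 0 and the lower end
  in the last row stay unpaired, and each is a single row count.\<close>

lemma sum_bk_lo_hi:
  assumes "ssyt lam T"
  shows "(\<Sum>i<length lam. bk_lo T i + bk_hi T i)
    = (\<Sum>i<length lam. row_count lam T k i + row_count lam T (k + 2) i)"
proof (cases "length lam")
  case (Suc n)
  let ?a = "row_count lam T k" and ?g = "row_count lam T (k + 2)"
  have zero: "row_count lam T a (Suc n) = 0" for a
    using Suc by (simp add: row_count_def cells_iff)
  have "(\<Sum>i<Suc n. bk_lo T i) = (\<Sum>i<n. max (?a i) (?g (Suc i))) + ?a n"
    by (simp add: zero)
  moreover have "(\<Sum>i<Suc n. bk_hi T i) = ?g 0 + (\<Sum>i<n. min (?g (Suc i)) (?a i))"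
    by (subst sum.lessThan_Suc_shift) simp
  moreover have "(\<Sum>i<n. max (?a i) (?g (Suc i))) + (\<Sum>i<n. min (?g (Suc i)) (?a i))
      = (\<Sum>i<n. ?a i) + (\<Sum>i<n. ?g (Suc i))"
    unfolding sum.distrib [symmetric] by (intro sum.cong refl) (simp add: max_def min_def)
  moreover have "(\<Sum>i<Suc n. ?g i) = ?g 0 + (\<Sum>i<n. ?g (Suc i))"
    by (subst sum.lessThan_Suc_shift) simp
  ultimately show ?thesis
    unfolding Suc sum.distrib by simp
qed simp

lemma bk_tabs:
  assumes "is_partition lam" "k \<ge> 1" "T \<in> tabs lam w"
  shows "bender_knuth T \<in> tabs lam (w(k := w (Suc k), Suc k := w k))"
proof -
  have T: "ssyt lam T" and w: "\<And>a. w a = card {c \<in> cells lam. T c = a}"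
    using assms(3) by (auto simp: tabs_def)
  note bounds = bk_bounds [OF assms(1,2) T]
  let ?a = "row_count lam T k" and ?b = "row_count lam T (k + 1)" and ?g = "row_count lam T (k + 2)"
  note T' = ssyt_bk [OF assms(1,2) T]
  note rc = row_count_bk [OF assms(1,2) T]
  have le: "?a i \<le> ?b i" "?b i \<le> ?g i" "?a i \<le> bk_mid T i" "bk_mid T i \<le> ?g i"
    and mid: "bk_mid T i + ?b i = bk_lo T i + bk_hi T i" for i
    using bounds [of i] unfolding bk_mid_def by (auto split: if_splits)
  have total: "(\<Sum>i<length lam. bk_mid T i) + (\<Sum>i<length lam. ?b i) = (\<Sum>i<length lam. ?a i) + (\<Sum>i<length lam. ?g i)"
    unfolding sum.distrib [symmetric] mid by (rule sum_bk_lo_hi [OF T])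
  have diff: "(\<Sum>i<length lam. f i - g i) = (\<Sum>i<length lam. f i) - (\<Sum>i<length lam. g i)"
    "(\<Sum>i<length lam. g i) \<le> (\<Sum>i<length lam. f i)"
    if "\<And>i. g i \<le> f i" for f g :: "nat \<Rightarrow> nat"
    using that by (auto intro: sum_subtractf_nat sum_mono)
  have "card {c \<in> cells lam. bender_knuth T c = a} = (w(k := w (Suc k), Suc k := w k)) a" for a
  proof -
    consider "a = k" | "a = Suc k" | "a \<noteq> k" "a \<noteq> Suc k" by blast
    then show ?thesis
    proof cases
      case 1
      then have "card {c \<in> cells lam. bender_knuth T c = a} = (\<Sum>i<length lam. bk_mid T i - ?a i)"
        by (simp add: card_entries [OF T'] rc)
      also have "\<dots> = (\<Sum>i<length lam. ?g i - ?b i)"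
        using total diff [of ?a "bk_mid T"] diff [of ?b ?g] le by simp
      also have "\<dots> = w (Suc k)"
        by (simp add: w card_entries [OF T])
      finally show ?thesis using 1 by simp
    next
      case 2
      then have "card {c \<in> cells lam. bender_knuth T c = a} = (\<Sum>i<length lam. ?g i - bk_mid T i)"
        by (simp add: card_entries [OF T'] rc)
      also have "\<dots> = (\<Sum>i<length lam. ?b i - ?a i)"
        using total diff [of "bk_mid T" ?g] diff [of ?a ?b] le by simp
      also have "\<dots> = w k"
        by (simp add: w card_entries [OF T])
      finally show ?thesis using 2 by simp
    next
      case 3
      then show ?thesis
        by (simp add: w card_entries [OF T'] card_entries [OF T] rc)
    qed
  qed
  then show ?thesis
    using T' by (simp add: tabs_def)
qed

end

lemma kostka_swap:
  assumes "is_partition lam" "k \<ge> 1"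
  shows "kostka lam (w(k := w (Suc k), Suc k := w k)) = kostka lam w"
proof -
  let ?w = "w(k := w (Suc k), Suc k := w k)"
  have restore: "?w(k := ?w (Suc k), Suc k := ?w k) = w" by auto
  have "bij_betw (bender_knuth lam k) (tabs lam w) (tabs lam ?w)"
  proof (rule bij_betw_byWitness [where f' = "bender_knuth lam k"])
    show "bender_knuth lam k ` tabs lam w \<subseteq> tabs lam ?w"
      using bk_tabs [OF assms] by blast
    show "bender_knuth lam k ` tabs lam ?w \<subseteq> tabs lam w"
      using bk_tabs [OF assms, of _ ?w] unfolding restore by blast
  qed (use bk_involution [OF assms] in \<open>auto simp: tabs_def\<close>)
  then show ?thesis
    unfolding kostka_def by (rule bij_betw_same_card [symmetric])
qed

section \<open>Kostka numbers and triangularity\<close>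

definition weight_of :: "nat list \<Rightarrow> nat \<Rightarrow> nat" where
  "weight_of xs k = (if 1 \<le> k \<and> k \<le> length xs then xs ! (k - 1) else 0)"

definition swap_invariant :: "((nat \<Rightarrow> nat) \<Rightarrow> 'a) \<Rightarrow> bool" where
  "swap_invariant F \<longleftrightarrow> (\<forall>w k. k \<ge> 1 \<longrightarrow> F (w(k := w (Suc k), Suc k := w k)) = F w)"

lemma weight_of_swap:
  "weight_of (us @ b # a # vs) = (weight_of (us @ a # b # vs))
     (Suc (length us) := weight_of (us @ a # b # vs) (Suc (Suc (length us))),
      Suc (Suc (length us)) := weight_of (us @ a # b # vs) (Suc (length us)))"
  by (rule ext) (auto simp: weight_of_def nth_append nth_Cons split: nat.splits)

lemma weight_of_adjacent:
  assumes "swap_invariant F"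
  shows "F (weight_of (us @ b # a # vs)) = F (weight_of (us @ a # b # vs))"
  unfolding weight_of_swap [of us b a vs] using assms by (simp add: swap_invariant_def)

lemma weight_of_move:
  assumes "swap_invariant F"
  shows "F (weight_of (us @ ys @ x # zs)) = F (weight_of (us @ x # ys @ zs))"
proof (induction ys arbitrary: us)
  case (Cons y ys)
  have "F (weight_of (us @ (y # ys) @ x # zs)) = F (weight_of ((us @ [y]) @ ys @ x # zs))" by simp
  also have "\<dots> = F (weight_of ((us @ [y]) @ x # ys @ zs))" by (rule Cons.IH)
  also have "\<dots> = F (weight_of (us @ x # y # ys @ zs))"
    using weight_of_adjacent [OF assms, of us y x "ys @ zs"] by simp
  finally show ?case by simp
qed simp

lemma weight_of_mset:
  assumes "swap_invariant F"
  shows "mset xs = mset ys \<Longrightarrow> F (weight_of (us @ xs)) = F (weight_of (us @ ys))"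
proof (induction xs arbitrary: us ys)
  case (Cons x xs)
  then have "x \<in> set ys"
    by (metis list.set_intros(1) set_mset_mset)
  then obtain y1 y2 where ys: "ys = y1 @ x # y2"
    by (auto simp: in_set_conv_decomp)
  then have "mset xs = mset (y1 @ y2)" using Cons.prems by simp
  then have "F (weight_of ((us @ [x]) @ xs)) = F (weight_of ((us @ [x]) @ y1 @ y2))"
    by (rule Cons.IH)
  then show ?case
    by (simp add: ys weight_of_move [OF assms])
qed simp

lemma weight_of_append_zeros: "weight_of (xs @ replicate n 0) = weight_of xs"
  by (rule ext) (auto simp: weight_of_def nth_append)

text \<open>\<open>F\<close> is quantified inside the conclusion, so one partition serves Kostka
  numbers, their linear combinations and the series at the same time.\<close>

lemma partition_representative:
  assumes "finite {k. w k \<noteq> 0}" "w 0 = (0 :: nat)"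
  obtains mu where "is_partition mu" "\<And>F. swap_invariant F \<Longrightarrow> (F w :: 'a) = F (weight_of mu)"
proof -
  obtain N where N: "\<And>k. w k \<noteq> 0 \<Longrightarrow> k \<le> N"
    using assms(1) by (metis (mono_tags, lifting) finite_nat_set_iff_bounded_le mem_Collect_eq)
  define xs where "xs = map w [1..<Suc N]"
  define mu where "mu = filter (\<lambda>x. x \<noteq> 0) (rev (sort xs))"
  have w: "weight_of xs = w"
  proof
    fix k show "weight_of xs k = w k"
      using N [of k] assms(2)
      by (cases "k = 0"; cases "w k = 0") (auto simp: weight_of_def xs_def simp del: upt_Suc)
  qed
  have "sorted_wrt (\<ge>) (rev (sort xs))"
    using sorted_wrt_rev [of "(\<ge>)" "sort xs"] by (simp add: sorted_sort)
  then have "is_partition mu"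
    by (auto simp: is_partition_def mu_def sorted_wrt_filter)
  moreover have "F w = F (weight_of mu)" if F: "swap_invariant F" for F :: "(nat \<Rightarrow> nat) \<Rightarrow> 'a"
  proof -
    let ?n = "length (filter (\<lambda>x. x = 0) xs)"
    have zeros: "mset (replicate ?n 0) = filter_mset (\<lambda>x. x = 0) (mset xs)"
      by (induction xs) auto
    have nonzeros: "mset mu = filter_mset (\<lambda>x. x \<noteq> 0) (mset xs)"
      by (simp add: mu_def)
    have "mset xs = mset (mu @ replicate ?n 0)"
      unfolding mset_append zeros nonzeros using multiset_partition [of "mset xs" "\<lambda>x. x \<noteq> 0"] by simp
    then have "F (weight_of ([] @ xs)) = F (weight_of ([] @ mu @ replicate ?n 0))"
      by (rule weight_of_mset [OF F])
    then show ?thesis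
      by (simp add: w weight_of_append_zeros)
  qed
  ultimately show ?thesis by (rule that)
qed

text \<open>The sum of the entries of a tableau of content \<open>mu\<close> is \<open>row_weight mu\<close>, and each entry is
  at least its row number; so \<open>row_weight\<close> plays the role of the dominance order.\<close>

definition row_weight :: "nat list \<Rightarrow> nat" where
  "row_weight lam = (\<Sum>c\<in>cells lam. Suc (fst c))"

lemma row_weight_nth: "row_weight lam = (\<Sum>i<length lam. Suc i * lam ! i)"
proof -
  have "row_weight lam = (\<Sum>i<length lam. \<Sum>j<lam ! i. Suc i)"
    unfolding row_weight_def cells_Sigma by (subst sum.Sigma) (auto simp: case_prod_unfold)
  then show ?thesis by (simp add: mult.commute)
qed

lemma tabsD:
  assumes "T \<in> tabs lam w"
  shows "ssyt lam T" "w k = card {c \<in> cells lam. T c = k}"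
  using assms by (auto simp: tabs_def)

lemma ssyt_outside: "ssyt lam T \<Longrightarrow> c \<notin> cells lam \<Longrightarrow> T c = undefined"
  unfolding ssyt_def by (metis PiE_arb)

lemma tabs_entry_pos:
  assumes "T \<in> tabs lam w" "c \<in> cells lam"
  shows "w (T c) > 0"
proof -
  have "c \<in> {c' \<in> cells lam. T c' = T c}" using assms(2) by simp
  then have "card {c' \<in> cells lam. T c' = T c} > 0"
    by (subst card_gt_0_iff) (cases c, auto)
  then show ?thesis using tabsD(2) [OF assms(1)] by simp
qed

lemma sum_entries:
  assumes T: "T \<in> tabs lam (weight_of mu)"
  shows "(\<Sum>c\<in>cells lam. T c) = row_weight mu"
proof -
  have "T c \<in> {1..length mu}" if "c \<in> cells lam" for c
    using tabs_entry_pos [OF T that] by (auto simp: weight_of_def split: if_splits)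
  then have "(\<Sum>c\<in>cells lam. T c) = (\<Sum>k\<in>{1..length mu}. \<Sum>c | c \<in> cells lam \<and> T c = k. T c)"
    by (intro sum.group [symmetric]) auto
  also have "\<dots> = (\<Sum>k\<in>{1..length mu}. k * weight_of mu k)"
    by (intro sum.cong refl) (simp add: tabsD(2) [OF T])
  also have "\<dots> = (\<Sum>i<length mu. Suc i * mu ! i)"
    by (rule sum.reindex_bij_witness [of _ Suc "\<lambda>k. k - 1"]) (auto simp: weight_of_def)
  finally show ?thesis by (simp add: row_weight_nth)
qed

lemma weight_of_inj:
  assumes "weight_of xs = weight_of ys" "0 \<notin> set xs" "0 \<notin> set ys"
  shows "xs = ys"
proof -
  have le: "length ys \<le> length xs" if "weight_of xs = weight_of ys" "0 \<notin> set ys" for xs ys :: "nat list"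
  proof (rule ccontr)
    assume "\<not> ?thesis"
    then have "weight_of xs (length ys) = 0" "weight_of ys (length ys) = ys ! (length ys - 1)" "length ys - 1 < length ys"
      by (auto simp: weight_of_def)
    then show False using that nth_mem by metis
  qed
  have len: "length xs = length ys"
    using le [of xs ys] le [of ys xs] assms by simp
  show ?thesis
  proof (rule nth_equalityI [OF len])
    fix i assume "i < length xs"
    then show "xs ! i = ys ! i"
      using fun_cong [OF assms(1), of "Suc i"] len by (simp add: weight_of_def)
  qed
qed

lemma weight_superstandard:
  "weight_of lam k = card {c \<in> cells lam. Suc (fst c) = k}"
proof -
  have "{c \<in> cells lam. Suc (fst c) = k} = (if 1 \<le> k \<and> k \<le> length lam then {k - 1} \<times> {..<lam ! (k - 1)} else {})"
    by (auto simp: cells_def)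
  then show ?thesis
    by (simp add: weight_of_def)
qed

text \<open>Comparing entries with row numbers and summing compares the row weights. Equality forces
  every entry to equal its row number, so the content is the shape.\<close>

lemma kostka_triangular:
  assumes "is_partition lam" "is_partition mu" "kostka lam (weight_of mu) \<noteq> 0"
  shows "lam = mu \<or> row_weight lam < row_weight mu"
proof -
  obtain T where T: "T \<in> tabs lam (weight_of mu)"
    using assms(3) unfolding kostka_def by (metis card.empty ex_in_conv)
  have ge: "Suc (fst c) \<le> T c" if "c \<in> cells lam" for c
    using ssyt_ge_row [OF assms(1) tabsD(1) [OF T]] that by (cases c) auto
  then have "(\<Sum>c\<in>cells lam. Suc (fst c)) \<le> (\<Sum>c\<in>cells lam. T c)"
    by (rule sum_mono)
  then have "row_weight lam \<le> row_weight mu"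
    by (simp only: sum_entries [OF T] row_weight_def [of lam])
  moreover have "lam = mu" if "row_weight lam = row_weight mu"
  proof -
    have eq: "Suc (fst c) = T c" if "c \<in> cells lam" for c
      using \<open>row_weight lam = row_weight mu\<close> ge that
      unfolding row_weight_def [of lam] sum_entries [OF T, symmetric]
      by (intro sum_mono_inv [of "\<lambda>c. Suc (fst c)" "cells lam" T]) auto
    have "weight_of lam = weight_of mu"
    proof
      fix k
      have "{c \<in> cells lam. Suc (fst c) = k} = {c \<in> cells lam. T c = k}"
        using eq by auto
      then show "weight_of lam k = weight_of mu k"
        by (simp add: weight_superstandard [of lam] tabsD(2) [OF T])
    qed
    then show ?thesis
      using assms(1,2) weight_of_inj by (simp add: is_partition_def)
  qed
  ultimately show ?thesis by linarith
qed

lemma kostka_diagonal: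
  assumes "is_partition lam"
  shows "kostka lam (weight_of lam) = 1"
proof -
  let ?T = "restrict (\<lambda>c. Suc (fst c)) (cells lam)"
  have "?T \<in> tabs lam (weight_of lam)"
  proof -
    have "{c \<in> cells lam. ?T c = k} = {c \<in> cells lam. Suc (fst c) = k}" for k
      by auto
    moreover have "ssyt lam ?T"
      unfolding ssyt_def
    proof (intro conjI allI impI)
      fix i j assume c: "(i, Suc j) \<in> cells lam"
      with cells_left [OF c, of j] show "?T (i, j) \<le> ?T (i, Suc j)" by simp
    next
      fix i j assume c: "(Suc i, j) \<in> cells lam"
      with cells_up [OF assms c] show "?T (i, j) < ?T (Suc i, j)" by simp
    qed auto
    ultimately show ?thesis
      by (simp add: tabs_def weight_superstandard)
  qed
  moreover have "T = ?T" if T: "T \<in> tabs lam (weight_of lam)" for T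
  proof
    fix c
    have ge: "Suc (fst c) \<le> T c" if "c \<in> cells lam" for c
      using ssyt_ge_row [OF assms tabsD(1) [OF T]] that by (cases c) auto
    show "T c = ?T c"
    proof (cases "c \<in> cells lam")
      case True
      then have "Suc (fst c) = T c"
        using ge sum_entries [OF T] unfolding row_weight_def [of lam]
        by (intro sum_mono_inv [of "\<lambda>c. Suc (fst c)" "cells lam" T]) auto
      with True show ?thesis by simp
    next
      case False
      with ssyt_outside [OF tabsD(1) [OF T]] show ?thesis by simp
    qed
  qed
  ultimately have "tabs lam (weight_of lam) = {?T}" by blast
  then show ?thesis by (simp add: kostka_def)
qed

text \<open>For existence, indices enter in increasing order of \<open>f\<close>: the column of a
  new index vanishes at all earlier ones, so solved equations are not disturbed, and the diagonal 1
  avoids division. Uniqueness is induction on \<open>f\<close>.\<close>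

lemma unitriangular_solve:
  fixes K :: "'a \<Rightarrow> 'a \<Rightarrow> int" and f :: "'a \<Rightarrow> nat"
  assumes "finite P" "\<And>a. a \<in> P \<Longrightarrow> K a a = 1"
    and "\<And>a b. a \<in> P \<Longrightarrow> b \<in> P \<Longrightarrow> K a b \<noteq> 0 \<Longrightarrow> a = b \<or> f a < f b"
  shows "\<exists>!c. (\<forall>a. a \<notin> P \<longrightarrow> c a = 0) \<and> (\<forall>b\<in>P. (\<Sum>a\<in>P. c a * K a b) = t b)"
proof -
  have ex: "\<exists>c. (\<forall>a. a \<notin> P \<longrightarrow> c a = 0) \<and> (\<forall>b\<in>P. (\<Sum>a\<in>P. c a * K a b) = t b)"
    using assms
  proof (induction P rule: finite_ranking_induct [where f = f])
    case (insert x S)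
    show ?case
    proof (cases "x \<in> S")
      case True
      with insert show ?thesis by (simp add: insert_absorb)
    next
      case False
      obtain c where c: "\<And>a. a \<notin> S \<Longrightarrow> c a = 0" "\<And>b. b \<in> S \<Longrightarrow> (\<Sum>a\<in>S. c a * K a b) = t b"
        using insert.IH insert.prems by (metis insertCI)
      define c' where "c' = c(x := t x - (\<Sum>a\<in>S. c a * K a x))"
      have S: "(\<Sum>a\<in>S. c' a * K a b) = (\<Sum>a\<in>S. c a * K a b)" for b
        using False by (intro sum.cong) (auto simp: c'_def)
      have "K x b = 0" if "b \<in> S" for b
        using insert.prems(2) [of x b] insert.hyps(2) [OF that] that False by fastforce
      then have "(\<Sum>a\<in>insert x S. c' a * K a b) = t b" if "b \<in> insert x S" for b
        using that False insert.hyps(1) insert.prems(1) [of x] c(2) by (auto simp: S) (simp add: c'_def)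
      moreover have "c' a = 0" if "a \<notin> insert x S" for a
        using that c(1) by (auto simp: c'_def)
      ultimately show ?thesis by blast
    qed
  qed auto
  moreover have "c = c'"
    if c: "(\<forall>a. a \<notin> P \<longrightarrow> c a = 0) \<and> (\<forall>b\<in>P. (\<Sum>a\<in>P. c a * K a b) = t b)"
      and c': "(\<forall>a. a \<notin> P \<longrightarrow> c' a = 0) \<and> (\<forall>b\<in>P. (\<Sum>a\<in>P. c' a * K a b) = t b)" for c c'
  proof -
    have "c b = c' b" if "b \<in> P" for b
      using that
    proof (induction "f b" arbitrary: b rule: less_induct)
      case less
      have "(\<Sum>a\<in>P. (c a - c' a) * K a b) = 0"
        using c c' less.prems by (simp add: left_diff_distrib sum_subtractf)
      moreover have "(\<Sum>a\<in>P. (c a - c' a) * K a b) = (\<Sum>a\<in>P. if a = b then c b - c' b else 0)"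
        using less assms by (intro sum.cong refl) (metis diff_self mult.right_neutral mult_eq_0_iff)
      ultimately show ?case
        using assms(1) less.prems by simp
    qed
    with c c' show ?thesis by (metis ext)
  qed
  ultimately show ?thesis by (rule ex_ex1I)
qed

lemma finite_partitions_of: "finite (partitions_of d)"
proof (rule finite_subset)
  show "partitions_of d \<subseteq> {xs. set xs \<subseteq> {..d} \<and> length xs \<le> d}"
  proof
    fix mu assume "mu \<in> partitions_of d"
    then have sum: "sum_list mu = d" and pos: "0 \<notin> set mu"
      by (auto simp: partitions_of_def is_partition_def)
    have "length mu \<le> sum_list mu"
      using pos by (induction mu) (auto simp: Suc_le_eq intro: add_less_le_mono add_mono)
    moreover have "set mu \<subseteq> {..d}"
      using sum member_le_sum_list by auto
    ultimately show "mu \<in> {xs. set xs \<subseteq> {..d} \<and> length xs \<le> d}"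
      using sum by simp
  qed
qed (simp add: finite_lists_length_le)

section \<open>Schur coefficients of two-row shapes\<close>

lemma finite_weight_of: "finite {k. weight_of xs k \<noteq> 0}"
  by (rule finite_subset [of _ "{..length xs}"]) (auto simp: weight_of_def)

lemma sum_weight_tabs:
  assumes "T \<in> tabs lam w" "finite S" "{k. w k \<noteq> 0} \<subseteq> S"
  shows "(\<Sum>k\<in>S. w k) = sum_list lam"
proof -
  have "T c \<in> S" if "c \<in> cells lam" for c
    using tabs_entry_pos [OF assms(1) that] assms(3) by auto
  then have "(\<Sum>k\<in>S. \<Sum>c | c \<in> cells lam \<and> T c = k. 1) = (\<Sum>c\<in>cells lam. 1 :: nat)"
    using assms(2) by (intro sum.group) auto
  then show ?thesis
    by (simp add: tabsD(2) [OF assms(1)] card_cells)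
qed

lemma kostka_eq_0_degree:
  assumes "finite S" "{k. w k \<noteq> 0} \<subseteq> S" "(\<Sum>k\<in>S. w k) \<noteq> sum_list lam"
  shows "kostka lam w = 0"
  using sum_weight_tabs [OF _ assms(1,2)] assms(3) unfolding kostka_def by (metis card.empty ex_in_conv)

lemma kostka_eq_0_index_0:
  assumes "w 0 \<noteq> 0"
  shows "kostka lam w = 0"
proof -
  have "T \<notin> tabs lam w" for T
  proof
    assume T: "T \<in> tabs lam w"
    then have "{c \<in> cells lam. T c = 0} = {}"
      using ssyt_ge_1 [OF tabsD(1)] by fastforce
    with T show False using tabsD(2) [OF T, of 0] assms by (simp only: card.empty)
  qed
  then have "tabs lam w = {}" by blast
  then show ?thesis by (simp add: kostka_def)
qed

lemma sum_weight_of: "(\<Sum>k\<le>length xs. weight_of xs k) = sum_list xs"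
proof -
  have "(\<Sum>k\<le>length xs. weight_of xs k) = (\<Sum>i<length xs. xs ! i)"
    by (subst sum.atMost_shift) (simp add: weight_of_def)
  then show ?thesis by (simp add: sum_list_sum_nth atLeast0LessThan)
qed

lemma monomial_of_weight:
  obtains m where "Poly_Mapping.lookup m = weight_of xs" "mdeg m = sum_list xs"
proof
  let ?m = "Abs_poly_mapping (weight_of xs)"
  show lookup: "Poly_Mapping.lookup ?m = weight_of xs"
    by (rule lookup_Abs_poly_mapping [OF finite_weight_of])
  have "mdeg ?m = (\<Sum>k\<le>length xs. weight_of xs k)"
    unfolding mdeg_def lookup
    by (rule sum.mono_neutral_left) (auto simp: in_keys_iff lookup weight_of_def split: if_splits)
  then show "mdeg ?m = sum_list xs"
    by (simp add: sum_weight_of)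
qed

lemma swap_invariant_schur_sum:
  assumes "P \<subseteq> {mu. is_partition mu}"
  shows "swap_invariant (\<lambda>w. \<Sum>mu\<in>P. c mu * int (kostka mu w))"
  unfolding swap_invariant_def using assms kostka_swap by (auto intro!: sum.cong)

text \<open>The equations are provided for arbitrary lists because the contents used later, such as
  \<open>[Suc p, q - 1]\<close>, may end in 0 and then are not partitions.\<close>

lemma schur_coeff_eqs:
  fixes F :: mseries and G :: "(nat \<Rightarrow> nat) \<Rightarrow> int" and lam :: "nat list"
  assumes F: "\<And>m. F m = G (Poly_Mapping.lookup m)"
    and G: "swap_invariant G" "\<And>w. w 0 \<noteq> 0 \<Longrightarrow> G w = 0"
  defines "P \<equiv> partitions_of (sum_list lam)"
  obtains c where "schur_coeff F lam = c lam"
    "\<And>xs. sum_list xs = sum_list lam \<Longrightarrow> (\<Sum>mu\<in>P. c mu * int (kostka mu (weight_of xs))) = G (weight_of xs)"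
proof -
  define d where "d = sum_list lam"
  let ?S = "\<lambda>c w. \<Sum>mu\<in>P. c mu * int (kostka mu w)"
  have P: "finite P" "mu \<in> P \<Longrightarrow> is_partition mu" "mu \<in> P \<Longrightarrow> sum_list mu = d" for mu
    using finite_partitions_of [of d] unfolding P_def d_def by (simp_all add: partitions_of_def)
  have all: "hom_component d F m = ?S c (Poly_Mapping.lookup m)"
    if c: "\<And>mu. mu \<in> P \<Longrightarrow> ?S c (weight_of mu) = G (weight_of mu)" for c m
  proof -
    let ?w = "Poly_Mapping.lookup m"
    have fin: "finite {k. ?w k \<noteq> 0}" by simp
    have "{k. ?w k \<noteq> 0} = Poly_Mapping.keys m" by (simp add: keys.rep_eq)
    then have mdeg: "(\<Sum>k | ?w k \<noteq> 0. ?w k) = mdeg m" by (simp only: mdeg_def)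
    consider "mdeg m \<noteq> d" | "?w 0 \<noteq> 0" | "mdeg m = d" "?w 0 = 0" by blast
    then show ?thesis
    proof cases
      case 1
      then have "kostka mu ?w = 0" if "mu \<in> P" for mu
        using P(3) [OF that] mdeg kostka_eq_0_degree [OF fin order_refl, of mu] by metis
      with 1 show ?thesis by (simp add: hom_component_def)
    next
      case 2
      then show ?thesis by (simp add: hom_component_def F G(2) kostka_eq_0_index_0)
    next
      case 3
      obtain mu where mu: "is_partition mu" "\<And>H :: (nat \<Rightarrow> nat) \<Rightarrow> int. swap_invariant H \<Longrightarrow> H ?w = H (weight_of mu)"
        using partition_representative [OF fin 3(2)] by metis
      have inv: "swap_invariant (\<lambda>w. int (kostka nu w))" if "is_partition nu" for nu
        using kostka_swap [OF that] by (simp add: swap_invariant_def)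
      \<comment> \<open>The size of \<open>mu\<close> is recovered from symmetry: the diagonal
        Kostka number 1 is also the value at \<open>?w\<close>, and a nonzero value forces the
        degrees to agree.\<close>
      have "int (kostka mu ?w) = int (kostka mu (weight_of mu))"
        by (rule mu(2) [OF inv [OF mu(1)]])
      then have "kostka mu ?w \<noteq> 0"
        using kostka_diagonal [OF mu(1)] by simp
      then have "sum_list mu = mdeg m"
        using kostka_eq_0_degree [OF fin order_refl, of mu] unfolding mdeg by metis
      then have "mu \<in> P"
        using 3 mu(1) by (simp add: P_def partitions_of_def d_def)
      have "?S c ?w = ?S c (weight_of mu)"
        by (rule mu(2) [OF swap_invariant_schur_sum]) (use P(2) in auto)
      also have "\<dots> = G (weight_of mu)"
        by (rule c [OF \<open>mu \<in> P\<close>])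
      also have "\<dots> = G ?w"
        by (rule mu(2) [OF G(1), symmetric])
      finally show ?thesis using 3 by (simp add: hom_component_def F)
    qed
  qed
  have conv: "hom_component d F = (\<lambda>m. \<Sum>mu\<in>P. c mu * schur mu m) \<longleftrightarrow>
      (\<forall>mu\<in>P. ?S c (weight_of mu) = G (weight_of mu))" for c
  proof
    assume eq: "hom_component d F = (\<lambda>m. \<Sum>mu\<in>P. c mu * schur mu m)"
    show "\<forall>mu\<in>P. ?S c (weight_of mu) = G (weight_of mu)"
    proof
      fix mu assume "mu \<in> P"
      obtain m where lookup: "Poly_Mapping.lookup m = weight_of mu" and "mdeg m = d"
        using monomial_of_weight P(3) [OF \<open>mu \<in> P\<close>] by metis
      then show "?S c (weight_of mu) = G (weight_of mu)"
        using fun_cong [OF eq, of m] by (simp add: hom_component_def F lookup schur_eq_kostka)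
    qed
  next
    assume "\<forall>mu\<in>P. ?S c (weight_of mu) = G (weight_of mu)"
    then show "hom_component d F = (\<lambda>m. \<Sum>mu\<in>P. c mu * schur mu m)"
      using all [of c] by (auto simp: schur_eq_kostka)
  qed
  have "\<exists>!c. (\<forall>mu. mu \<notin> P \<longrightarrow> c mu = 0) \<and> (\<forall>mu\<in>P. ?S c (weight_of mu) = G (weight_of mu))"
  proof (rule unitriangular_solve [where f = row_weight])
    fix a b assume "a \<in> P" "b \<in> P" "int (kostka a (weight_of b)) \<noteq> 0"
    then show "a = b \<or> row_weight a < row_weight b"
      using kostka_triangular P(2) by simp
  qed (use P kostka_diagonal in auto)
  then have ex1: "\<exists>!c. (\<forall>mu. mu \<notin> P \<longrightarrow> c mu = 0) \<and> hom_component d F = (\<lambda>m. \<Sum>mu\<in>P. c mu * schur mu m)"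
    by (simp only: conv)
  define c where "c = (THE c. (\<forall>mu. mu \<notin> P \<longrightarrow> c mu = 0) \<and> hom_component d F = (\<lambda>m. \<Sum>mu\<in>P. c mu * schur mu m))"
  have eq: "hom_component d F = (\<lambda>m. \<Sum>mu\<in>P. c mu * schur mu m)"
    using theI' [OF ex1] unfolding c_def by blast
  show ?thesis
  proof (rule that [of c])
    show "schur_coeff F lam = c lam"
      by (simp add: schur_coeff_def c_def P_def d_def)
    fix xs :: "nat list" assume xs: "sum_list xs = sum_list lam"
    obtain m where lookup: "Poly_Mapping.lookup m = weight_of xs" and "mdeg m = d"
      using monomial_of_weight xs unfolding d_def by metis
    then show "?S c (weight_of xs) = G (weight_of xs)"
      using fun_cong [OF eq, of m] by (simp add: hom_component_def F lookup schur_eq_kostka)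
  qed
qed

section \<open>Kostka numbers with two-part content\<close>

definition second_part :: "nat list \<Rightarrow> nat" where
  "second_part mu = (if length mu \<ge> 2 then mu ! 1 else 0)"

text \<open>With entries 1 and 2 only, the second row consists of 2s and the first row starts with
  \<open>p\<close> 1s, so there is at most one tableau. It exists once the 2s suffice for the second
  row; \<open>q \<le> p\<close> then puts a 1 above each of them.\<close>

lemma kostka_two:
  assumes mu: "is_partition mu" "sum_list mu = p + q" and "q \<le> p"
  shows "kostka mu (weight_of [p, q]) = (if length mu \<le> 2 \<and> second_part mu \<le> q then 1 else 0)"
proof -
  let ?w = "weight_of [p, q]"
  have w: "?w k = (if k = 1 then p else if k = 2 then q else 0)" for k
    by (auto simp: weight_of_def nth_Cons split: nat.splits)
  have entry: "T c = 1 \<or> T c = 2" if "T \<in> tabs mu ?w" "c \<in> cells mu" for T c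
    using tabs_entry_pos [OF that] by (auto simp: w split: if_splits)
  have row1: "i = 0 \<or> i = 1 \<and> T (i, j) = 2" if "T \<in> tabs mu ?w" "(i, j) \<in> cells mu" for T i j
    using entry [OF that] ssyt_ge_row [OF mu(1) tabsD(1) [OF that(1)] that(2)] by auto
  have pos: "mu ! i > 0" if "i < length mu" for i
    using mu(1) nth_mem [OF that] unfolding is_partition_def by (metis gr0I)
  show ?thesis
  proof (cases "length mu \<le> 2 \<and> second_part mu \<le> q")
    case False
    have "T \<notin> tabs mu ?w" for T
    proof
      assume T: "T \<in> tabs mu ?w"
      have "length mu \<le> 2"
      proof (rule ccontr)
        assume "\<not> ?thesis"
        then have "(2, 0) \<in> cells mu" using pos by (simp add: cells_iff)
        then show False using row1 [OF T] by fastforce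
      qed
      have "{1} \<times> {..<second_part mu} \<subseteq> {c \<in> cells mu. T c = 2}"
      proof (rule subsetI)
        fix c :: "nat \<times> nat" assume "c \<in> {1} \<times> {..<second_part mu}"
        then obtain j where c: "c = (1, j)" "(1, j) \<in> cells mu"
          by (auto simp: second_part_def cells_iff split: if_splits)
        then show "c \<in> {c \<in> cells mu. T c = 2}" using row1 [OF T, of 1 j] by simp
      qed
      then have "card ({1 :: nat} \<times> {..<second_part mu}) \<le> card {c \<in> cells mu. T c = 2}"
        by (intro card_mono) auto
      then have "second_part mu \<le> q"
        using tabsD(2) [OF T, of 2] by (simp add: w card_cartesian_product)
      with \<open>length mu \<le> 2\<close> False show False by simp
    qed
    then have "tabs mu ?w = {}" by blast
    with False show ?thesis by (simp add: kostka_def)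
  next
    case True
    define r where "r = (if mu = [] then 0 else mu ! 0)"
    have cells: "cells mu = {0} \<times> {..<r} \<union> {1} \<times> {..<second_part mu}"
      using True by (cases mu rule: remdups_adj.cases) (auto simp: cells_def r_def second_part_def less_Suc_eq)
    have sum: "r + second_part mu = p + q"
    proof -
      have "card (cells mu) = r + second_part mu"
        unfolding cells by (subst card_Un_disjoint) (auto simp: card_cartesian_product)
      then show ?thesis using mu(2) by (simp add: card_cells)
    qed
    then have "p \<le> r" using True by simp
    define T0 where "T0 = restrict (\<lambda>(i, j). if i = 0 \<and> j < p then 1 else (2 :: nat)) (cells mu)"
    have "ssyt mu T0"
      unfolding ssyt_def
    proof (intro conjI allI impI)
      show "T0 \<in> cells mu \<rightarrow>\<^sub>E {1..}" by (auto simp: T0_def)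
    next
      fix i j assume c: "(i, Suc j) \<in> cells mu"
      with cells_left [OF c, of j] show "T0 (i, j) \<le> T0 (i, Suc j)" by (simp add: T0_def)
    next
      fix i j assume c: "(Suc i, j) \<in> cells mu"
      then have "i = 0" "j < p" using True \<open>q \<le> p\<close> by (auto simp: cells)
      with c cells_up [OF mu(1) c] show "T0 (i, j) < T0 (Suc i, j)" by (simp add: T0_def)
    qed
    moreover have "?w k = card {c \<in> cells mu. T0 c = k}" for k
    proof -
      have "{c \<in> cells mu. T0 c = 1} = {0} \<times> {..<p}"
        using \<open>p \<le> r\<close> by (auto simp: T0_def cells split: if_splits)
      moreover have "{c \<in> cells mu. T0 c = 2} = {0} \<times> {p..<r} \<union> {1} \<times> {..<second_part mu}"
        by (auto simp: T0_def cells split: if_splits)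
      moreover have "card ({0 :: nat} \<times> {p..<r} \<union> {1} \<times> {..<second_part mu}) = q"
        using sum \<open>p \<le> r\<close> by (subst card_Un_disjoint) (auto simp: card_cartesian_product)
      moreover have "{c \<in> cells mu. T0 c = k} = {}" if "k \<noteq> 1" "k \<noteq> 2"
        using that by (auto simp: T0_def)
      ultimately show ?thesis
        by (simp add: w card_cartesian_product)
    qed
    ultimately have T0: "T0 \<in> tabs mu ?w"
      by (simp add: tabs_def)
    moreover have "T = T0" if T: "T \<in> tabs mu ?w" for T
    proof
      fix c :: "nat \<times> nat"
      have one: "{c \<in> cells mu. T c = 1} = {0} \<times> {..<row_count mu T 2 0}"
      proof (rule set_eqI)
        fix c :: "nat \<times> nat"
        obtain i j where c: "c = (i, j)" by (cases c)
        show "c \<in> {c \<in> cells mu. T c = 1} \<longleftrightarrow> c \<in> {0} \<times> {..<row_count mu T 2 0}"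
          using row1 [OF T, of i j] entry [OF T, of "(i, j)"]
          by (auto simp: c less_row_count_iff [OF tabsD(1) [OF T]])
      qed
      have "p = card {c \<in> cells mu. T c = 1}"
        using tabsD(2) [OF T, of 1] by (simp add: w)
      then have p: "row_count mu T 2 0 = p"
        unfolding one by (simp add: card_cartesian_product)
      have "T c = (if fst c = 0 \<and> snd c < p then 1 else 2)" if c: "c \<in> cells mu"
      proof -
        have "T c = 1 \<longleftrightarrow> fst c = 0 \<and> snd c < p"
          using arg_cong [OF one, of "\<lambda>S. c \<in> S"] c unfolding p by (simp add: mem_Times_iff)
        then show ?thesis using entry [OF T c] by auto
      qed
      moreover have "T c = undefined" if "c \<notin> cells mu"
        using ssyt_outside [OF tabsD(1) [OF T] that] .
      ultimately show "T c = T0 c"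
        by (simp add: T0_def case_prod_unfold)
    qed
    ultimately have "tabs mu ?w = {T0}" by blast
    with True show ?thesis by (simp add: kostka_def)
  qed
qed

lemma partition_two_cases:
  assumes "is_partition mu" "length mu \<le> 2"
  obtains "mu = []" | a where "mu = [a]" "a > 0" | a b where "mu = [a, b]" "b \<le> a" "b > 0"
  using assms by (cases mu rule: remdups_adj.cases) (auto simp: is_partition_def)

lemma schur_coeff_two_rows:
  fixes F :: mseries and G :: "(nat \<Rightarrow> nat) \<Rightarrow> int"
  assumes F: "\<And>m. F m = G (Poly_Mapping.lookup m)"
    and G: "swap_invariant G" "\<And>w. w 0 \<noteq> 0 \<Longrightarrow> G w = 0"
    and lam: "is_partition lam" "length lam \<le> 2"
  shows "schur_coeff F lam = (if length lam = 2
    then G (weight_of lam) - G (weight_of [Suc (lam ! 0), lam ! 1 - 1]) else G (weight_of lam))"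
proof -
  let ?P = "partitions_of (sum_list lam)"
  obtain c where c: "schur_coeff F lam = c lam"
    "\<And>xs. sum_list xs = sum_list lam \<Longrightarrow> (\<Sum>mu\<in>?P. c mu * int (kostka mu (weight_of xs))) = G (weight_of xs)"
    using schur_coeff_eqs [OF F G] by blast
  have P: "finite ?P" "lam \<in> ?P" "mu \<in> ?P \<Longrightarrow> is_partition mu" "mu \<in> ?P \<Longrightarrow> sum_list mu = sum_list lam" for mu
    using lam finite_partitions_of by (auto simp: partitions_of_def)
  have delta: "(\<Sum>mu\<in>?P. c mu * (if mu = lam then 1 else 0)) = c lam"
  proof -
    have "(\<Sum>mu\<in>?P. c mu * (if mu = lam then 1 else 0)) = (\<Sum>mu\<in>?P. if mu = lam then c mu else 0)"
      by (intro sum.cong) auto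
    then show ?thesis using P(1,2) by simp
  qed
  have coeff: "c lam = G (weight_of [p, 0])" if "p = sum_list lam" "length lam \<noteq> 2" for p
  proof -
    have "kostka mu (weight_of [p, 0]) = (if mu = lam then 1 else 0)" if mu: "mu \<in> ?P" for mu
    proof -
      have "length mu \<le> 2 \<and> second_part mu \<le> 0 \<longleftrightarrow> mu = lam"
      proof
        assume *: "length mu \<le> 2 \<and> second_part mu \<le> 0"
        then have "length mu \<le> 2" by simp
        show "mu = lam"
          by (rule partition_two_cases [OF P(3) [OF mu] \<open>length mu \<le> 2\<close>]; rule partition_two_cases [OF lam])
             (use P(4) [OF mu] * \<open>length lam \<noteq> 2\<close> in \<open>auto simp: second_part_def\<close>)
      next
        assume "mu = lam"
        then show "length mu \<le> 2 \<and> second_part mu \<le> 0"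
          using lam \<open>length lam \<noteq> 2\<close> by (simp add: second_part_def)
      qed
      then show ?thesis
        using kostka_two [OF P(3) [OF mu], of p 0] P(4) [OF mu] that(1) \<open>p = sum_list lam\<close> by simp
    qed
    then have "c lam = (\<Sum>mu\<in>?P. c mu * int (kostka mu (weight_of [p, 0])))"
      unfolding delta [symmetric] by (intro sum.cong) auto
    then show ?thesis using c(2) [of "[p, 0]"] that(1) by simp
  qed
  have zero: "weight_of [p, 0] = weight_of [p]" "weight_of [0] = weight_of []" for p
    using weight_of_append_zeros [of "[p]" 1] weight_of_append_zeros [of "[]" 1] by simp_all
  from lam show ?thesis
  proof (cases rule: partition_two_cases)
    case 1
    then show ?thesis using coeff [of 0] c(1) by (simp add: zero)
  next
    case (2 a)
    then show ?thesis using coeff [of a] c(1) by (simp add: zero)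
  next
    case (3 p q)
    \<comment> \<open>The two Kostka numbers test whether the second part is at most
      \<open>q\<close> and at most \<open>q - 1\<close>, so the difference detects equality. This is
      the two-row Jacobi-Trudi determinant in dual form.\<close>
    have "int (kostka mu (weight_of [p, q])) - int (kostka mu (weight_of [Suc p, q - 1])) = (if mu = lam then 1 else 0)"
      if mu: "mu \<in> ?P" for mu
    proof -
      have "(length mu \<le> 2 \<and> second_part mu = q) \<longleftrightarrow> mu = lam"
      proof
        assume *: "length mu \<le> 2 \<and> second_part mu = q"
        then have "length mu \<le> 2" by simp
        show "mu = lam"
          by (rule partition_two_cases [OF P(3) [OF mu] \<open>length mu \<le> 2\<close>])
             (use P(4) [OF mu] * 3 in \<open>auto simp: second_part_def\<close>)
      qed (use 3 in \<open>auto simp: second_part_def\<close>)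
      moreover have "sum_list mu = p + q" "sum_list mu = Suc p + (q - 1)" "q - 1 \<le> Suc p"
        using P(4) [OF mu] 3 by auto
      ultimately show ?thesis
        using kostka_two [OF P(3) [OF mu], of p q] kostka_two [OF P(3) [OF mu], of "Suc p" "q - 1"] 3
        by (auto split: if_splits)
    qed
    then have "c lam = (\<Sum>mu\<in>?P. c mu * (int (kostka mu (weight_of [p, q])) - int (kostka mu (weight_of [Suc p, q - 1]))))"
      unfolding delta [symmetric] by (intro sum.cong) auto
    also have "\<dots> = G (weight_of [p, q]) - G (weight_of [Suc p, q - 1])"
      unfolding right_diff_distrib sum_subtractf
      using c(2) [of "[p, q]"] c(2) [of "[Suc p, q - 1]"] 3 by simp
    finally show ?thesis using c(1) 3 by simp
  qed
qed

section \<open>Multicolorings\<close>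

text \<open>The coefficient of a monomial in the product of the I(x_k). Colors outside the support
  would contribute \<open>indep_count G 0 = 1\<close>; leaving them out keeps the product
  finite.\<close>

definition indep_product :: "'v ugraph \<Rightarrow> (nat \<Rightarrow> nat) \<Rightarrow> int" where
  "indep_product G w = (if w 0 = 0 then \<Prod>k | w k \<noteq> 0. int (indep_count G (w k)) else 0)"

definition colorings :: "'v ugraph \<Rightarrow> (nat \<Rightarrow> nat) \<Rightarrow> ('v \<Rightarrow> nat set) set" where
  "colorings G w = {\<kappa> \<in> verts G \<rightarrow>\<^sub>E {C. finite C \<and> C \<subseteq> {1..}}.
     (\<forall>u v. {u, v} \<in> edges G \<longrightarrow> \<kappa> u \<inter> \<kappa> v = {}) \<and> (\<forall>i. w i = card {v \<in> verts G. i \<in> \<kappa> v})}"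

text \<open>Transposing the incidence between vertices and colors: a multicoloring is proper exactly
  when each color class is independent, and the content prescribes the class sizes.\<close>

lemma bij_betw_color_classes:
  assumes G: "simple_graph G" and w: "w 0 = 0" "finite {k. w k \<noteq> 0}"
  shows "bij_betw (\<lambda>\<kappa>. restrict (\<lambda>k. {v \<in> verts G. k \<in> \<kappa> v}) {k. w k \<noteq> 0})
    (colorings G w) (PiE {k. w k \<noteq> 0} (\<lambda>k. {S. independent G S \<and> card S = w k}))"
    (is "bij_betw ?\<psi> _ ?R")
proof -
  let ?K = "{k. w k \<noteq> 0}"
  let ?\<phi> = "\<lambda>g. restrict (\<lambda>v. {k \<in> ?K. v \<in> g k}) (verts G)"
  have fin: "finite (verts G)" and sub: "\<And>u v. {u, v} \<in> edges G \<Longrightarrow> u \<in> verts G \<and> v \<in> verts G"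
    using G by (auto simp: simple_graph_def)
  have support: "k \<in> ?K" if "\<kappa> \<in> colorings G w" "v \<in> verts G" "k \<in> \<kappa> v" for \<kappa> v k
  proof -
    have "card {v \<in> verts G. k \<in> \<kappa> v} > 0"
      using fin that by (subst card_gt_0_iff) auto
    then show ?thesis using that(1) by (simp add: colorings_def)
  qed
  show ?thesis
  proof (rule bij_betw_byWitness [where f' = ?\<phi>])
    show "\<forall>\<kappa>\<in>colorings G w. ?\<phi> (?\<psi> \<kappa>) = \<kappa>"
    proof (intro ballI ext)
      fix \<kappa> v assume \<kappa>: "\<kappa> \<in> colorings G w"
      show "?\<phi> (?\<psi> \<kappa>) v = \<kappa> v"
      proof (cases "v \<in> verts G")
        case True
        then show ?thesis using support [OF \<kappa> True] by auto
      next
        case False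
        have "\<kappa> \<in> verts G \<rightarrow>\<^sub>E {C. finite C \<and> C \<subseteq> {1..}}"
          using \<kappa> by (simp add: colorings_def)
        then show ?thesis using False PiE_arb by fastforce
      qed
    qed
  next
    show "\<forall>g\<in>?R. ?\<psi> (?\<phi> g) = g"
    proof (intro ballI ext)
      fix g k assume g: "g \<in> ?R"
      show "?\<psi> (?\<phi> g) k = g k"
      proof (cases "k \<in> ?K")
        case True
        then have "g k \<subseteq> verts G" using PiE_mem [OF g True] by (auto simp: independent_def)
        then show ?thesis using True by auto
      next
        case False
        then show ?thesis using PiE_arb [OF g False] by simp
      qed
    qed
  next
    show "?\<psi> ` colorings G w \<subseteq> ?R"
    proof (intro image_subsetI PiE_I)
      fix \<kappa> k assume \<kappa>: "\<kappa> \<in> colorings G w" and k: "k \<in> ?K"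
      then have disj: "\<And>u v. {u, v} \<in> edges G \<Longrightarrow> \<kappa> u \<inter> \<kappa> v = {}"
        and "card {v \<in> verts G. k \<in> \<kappa> v} = w k"
        unfolding colorings_def by simp_all
      moreover have "independent G {v \<in> verts G. k \<in> \<kappa> v}"
        unfolding independent_def using disj by blast
      ultimately show "?\<psi> \<kappa> k \<in> {S. independent G S \<and> card S = w k}"
        using k by simp
    qed simp
  next
    show "?\<phi> ` ?R \<subseteq> colorings G w"
    proof (rule image_subsetI)
      fix g assume g: "g \<in> ?R"
      have gk: "independent G (g k)" "card (g k) = w k" if "w k \<noteq> 0" for k
        using PiE_mem [OF g, of k] that by auto
      have "k \<ge> 1" if "w k \<noteq> 0" for k
        using that w(1) by (cases k) auto
      then have "?\<phi> g \<in> verts G \<rightarrow>\<^sub>E {C. finite C \<and> C \<subseteq> {1..}}"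
        using w(2) by auto
      moreover have "?\<phi> g u \<inter> ?\<phi> g v = {}" if "{u, v} \<in> edges G" for u v
      proof -
        have "\<not> (u \<in> g k \<and> v \<in> g k)" if "w k \<noteq> 0" for k
          using gk(1) [OF that] \<open>{u, v} \<in> edges G\<close> unfolding independent_def by blast
        then show ?thesis using sub [OF that] by auto
      qed
      moreover have "w i = card {v \<in> verts G. i \<in> ?\<phi> g v}" for i
      proof (cases "w i = 0")
        case False
        then have "{v \<in> verts G. i \<in> ?\<phi> g v} = g i"
          using gk(1) [OF False] unfolding independent_def by auto
        then show ?thesis using gk(2) [OF False] by simp
      qed simp
      ultimately show "?\<phi> g \<in> colorings G w"
        unfolding colorings_def by blast
    qed
  qed
qed

lemma colorings_index_0:
  assumes "w 0 \<noteq> 0"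
  shows "colorings G w = {}"
proof -
  have False if "\<kappa> \<in> colorings G w" for \<kappa>
  proof -
    have "\<kappa> \<in> verts G \<rightarrow>\<^sub>E {C. finite C \<and> C \<subseteq> {1..}}" and card: "w 0 = card {v \<in> verts G. 0 \<in> \<kappa> v}"
      using that unfolding colorings_def by blast+
    then have "{v \<in> verts G. 0 \<in> \<kappa> v} = {}"
      using PiE_mem by fastforce
    with card assms show False by (simp only: card.empty)
  qed
  then show ?thesis by blast
qed

lemma card_colorings:
  assumes "simple_graph G" "finite {k. w k \<noteq> 0}"
  shows "finite (colorings G w) \<and> int (card (colorings G w)) = indep_product G w"
proof (cases "w 0 = 0")
  case True
  let ?R = "PiE {k. w k \<noteq> 0} (\<lambda>k. {S. independent G S \<and> card S = w k})"
  note bij = bij_betw_color_classes [OF assms(1) True assms(2)]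
  have "finite ?R"
    using assms finite_independent by (intro finite_PiE) (auto intro: finite_subset [of _ "{S. independent G S}"])
  moreover have "card ?R = (\<Prod>k | w k \<noteq> 0. indep_count G (w k))"
    unfolding card_PiE [OF assms(2)] indep_count_def ..
  ultimately show ?thesis
    using bij_betw_finite [OF bij] bij_betw_same_card [OF bij] True by (simp add: indep_product_def)
qed (simp add: colorings_index_0 indep_product_def)

lemma Y_series_eq_indep_product:
  assumes G: "simple_graph G"
  shows "Y_series G m = indep_product G (Poly_Mapping.lookup m)"
proof -
  let ?w = "Poly_Mapping.lookup m"
  define K where "K = colorings G ?w"
  define size where "size = (\<lambda>\<kappa> :: 'a \<Rightarrow> nat set. restrict (\<lambda>v. card (\<kappa> v)) (verts G))"
  have K: "finite K" "int (card K) = indep_product G ?w"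
    using card_colorings [OF G, of ?w] by (simp_all add: K_def)
  have X: "X_series G \<alpha> m = int (card {\<kappa> \<in> K. size \<kappa> = \<alpha>})" if "\<alpha> \<in> verts G \<rightarrow>\<^sub>E UNIV" for \<alpha>
  proof -
    have "size \<kappa> = \<alpha> \<longleftrightarrow> (\<forall>v\<in>verts G. card (\<kappa> v) = \<alpha> v)" for \<kappa>
    proof
      assume "\<forall>v\<in>verts G. card (\<kappa> v) = \<alpha> v"
      then show "size \<kappa> = \<alpha>"
        using PiE_arb [OF that] unfolding size_def by (intro ext) (simp add: restrict_def)
    qed (auto simp: size_def)
    then have "{\<kappa>. proper_multicoloring G \<alpha> \<kappa> \<and> (\<forall>i. ?w i = card {v \<in> verts G. i \<in> \<kappa> v})} = {\<kappa> \<in> K. size \<kappa> = \<alpha>}"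
      unfolding K_def colorings_def proper_multicoloring_def multicoloring_def by blast
    then show ?thesis by (simp add: X_series_def)
  qed
  \<comment> \<open>Exactly the types attained by some coloring contribute, so the sum over types
    runs over the fibres of \<open>size\<close> and counts every coloring once.\<close>
  have "{\<alpha> \<in> verts G \<rightarrow>\<^sub>E UNIV. X_series G \<alpha> m \<noteq> 0} = size ` K"
  proof (intro equalityI subsetI)
    fix \<alpha> assume "\<alpha> \<in> {\<alpha> \<in> verts G \<rightarrow>\<^sub>E UNIV. X_series G \<alpha> m \<noteq> 0}"
    then have "card {\<kappa> \<in> K. size \<kappa> = \<alpha>} \<noteq> 0" using X [of \<alpha>] by auto
    then have "{\<kappa> \<in> K. size \<kappa> = \<alpha>} \<noteq> {}" by (metis card.empty)
    then show "\<alpha> \<in> size ` K" by blast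
  next
    fix \<alpha> assume "\<alpha> \<in> size ` K"
    then have "\<alpha> \<in> verts G \<rightarrow>\<^sub>E UNIV" "{\<kappa> \<in> K. size \<kappa> = \<alpha>} \<noteq> {}" by (auto simp: size_def)
    then show "\<alpha> \<in> {\<alpha> \<in> verts G \<rightarrow>\<^sub>E UNIV. X_series G \<alpha> m \<noteq> 0}"
      using X [of \<alpha>] K(1) by (auto simp: card_eq_0_iff)
  qed
  then have "Y_series G m = (\<Sum>\<alpha>\<in>size ` K. X_series G \<alpha> m)"
    by (simp add: Y_series_def)
  also have "\<dots> = (\<Sum>\<alpha>\<in>size ` K. int (card {\<kappa> \<in> K. size \<kappa> = \<alpha>}))"
    by (intro sum.cong refl X) (auto simp: size_def)
  also have "\<dots> = (\<Sum>\<alpha>\<in>size ` K. \<Sum>\<kappa> | \<kappa> \<in> K \<and> size \<kappa> = \<alpha>. 1)"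
    by simp
  also have "\<dots> = (\<Sum>\<kappa>\<in>K. 1)"
    using K(1) by (intro sum.group) auto
  finally show ?thesis using K(2) by simp
qed

lemma swap_invariant_indep_product: "swap_invariant (indep_product G)"
  unfolding swap_invariant_def
proof (intro allI impI)
  fix w :: "nat \<Rightarrow> nat" and k :: nat
  assume "k \<ge> 1"
  let ?w = "w(k := w (Suc k), Suc k := w k)"
  let ?s = "\<lambda>j. if j = k then Suc k else if j = Suc k then k else j"
  have "(\<Prod>j | ?w j \<noteq> 0. int (indep_count G (?w j))) = (\<Prod>j | w j \<noteq> 0. int (indep_count G (w j)))"
    by (rule prod.reindex_bij_witness [of _ ?s ?s]) (auto split: if_splits)
  with \<open>k \<ge> 1\<close> show "indep_product G ?w = indep_product G w"
    by (simp add: indep_product_def)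
qed

lemma indep_count_0:
  assumes "simple_graph G"
  shows "indep_count G 0 = 1"
proof -
  have "finite S" if "independent G S" for S
    using that assms finite_subset unfolding independent_def simple_graph_def by blast
  then have "{S. independent G S \<and> card S = 0} = {{}}"
    by (auto simp: independent_def)
  then show ?thesis by (simp add: indep_count_def)
qed

lemma indep_product_weight_of:
  assumes "simple_graph G"
  shows "indep_product G (weight_of xs) = (\<Prod>i<length xs. int (indep_count G (xs ! i)))"
proof -
  have "(\<Prod>k | weight_of xs k \<noteq> 0. int (indep_count G (weight_of xs k)))
      = (\<Prod>k\<in>{1..length xs}. int (indep_count G (weight_of xs k)))"
    by (rule prod.mono_neutral_left) (auto simp: weight_of_def indep_count_0 [OF assms] split: if_splits intro!: gr0I)
  also have "\<dots> = (\<Prod>i<length xs. int (indep_count G (xs ! i)))"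
    by (rule prod.reindex_bij_witness [of _ Suc "\<lambda>k. k - 1"]) (auto simp: weight_of_def)
  finally show ?thesis by (simp add: indep_product_def) (simp add: weight_of_def)
qed

theorem theorem3p1:
  fixes lam :: "nat list"
  assumes "is_partition lam"
  shows "two_s_positive (Y_series (spider lam)) \<and>
         strongly_log_concave (indep_poly (spider lam))"
proof
  have lam: "0 \<notin> set lam"
    using assms by (simp add: is_partition_def)
  then show "strongly_log_concave (indep_poly (spider lam))"
    by (rule spider_strongly_log_concave)
  let ?G = "indep_product (spider lam)"
  show "two_s_positive (Y_series (spider lam))"
    unfolding two_s_positive_def
  proof (intro allI impI, elim conjE)
    fix mu assume mu: "is_partition mu" "length mu \<le> 2"
    have coeff: "schur_coeff (Y_series (spider lam)) mu = (if length mu = 2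
        then ?G (weight_of mu) - ?G (weight_of [Suc (mu ! 0), mu ! 1 - 1]) else ?G (weight_of mu))"
      by (rule schur_coeff_two_rows [OF Y_series_eq_indep_product swap_invariant_indep_product _ mu])
         (simp_all add: simple_graph_spider indep_product_def)
    show "schur_coeff (Y_series (spider lam)) mu \<ge> 0"
    proof (cases "length mu = 2")
      case False
      then show ?thesis
        by (simp add: coeff indep_product_weight_of [OF simple_graph_spider] prod_nonneg)
    next
      case True
      obtain p q where pq: "mu = [p, q]" "q \<le> p" "q > 0"
        by (rule partition_two_cases [OF mu]) (use True in auto)
      \<comment> \<open>Strong log-concavity for the inner pair (q, p) and the outer pair (q - 1, p
        + 1), whose sums agree because \<open>q > 0\<close>.\<close>
      have "indep_count (spider lam) (q - 1) * indep_count (spider lam) (Suc p)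
          \<le> indep_count (spider lam) q * indep_count (spider lam) p"
        using pq by (intro indep_count_spider_log_concave [OF lam]) auto
      then have "int (indep_count (spider lam) (q - 1)) * int (indep_count (spider lam) (Suc p))
          \<le> int (indep_count (spider lam) q) * int (indep_count (spider lam) p)"
        by (simp only: of_nat_mult [symmetric] of_nat_le_iff)
      then show ?thesis
        by (simp add: pq(1) coeff [unfolded pq(1)] indep_product_weight_of [OF simple_graph_spider] lessThan_Suc mult_ac)
    qed
  qed
qed

end
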